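(* (Bounded Weak Convergence Theorem) Let $E,F$ be Banach spaces and let $\mu\colon\mathfrak{M}\to\mathcal{L}(E,F)$ be an i-measure, where $\mathfrak{M}$ is a $\sigma$-algebra on a set $Z$. If $f_n\in M_{\mathfrak{M}}(Z,E)$ are uniformly bounded and converge pointwise to $f\colon Z\to E$ in the weak topology of $E$, then $\int_Z f_n\,\mathrm{d}\mu$ converge to $\int_Z f\,\mathrm{d}\mu$ in the weak topology of $F$.
   Context: Banach spaces are over a fixed field $\mathbb{K}$ of real or complex numbers; $\mathcal{L}(E,F)$ is the Banach space of continuous linear operators $E\to F$. For $T_n\in\mathcal{L}(E,F)$, the series $\sum_n T_n$ is independently convergent if $\sum_n T_nx_n$ converges in the norm of $F$ for every bounded sequence $(x_n)$ in $E$. A set function $\mu\colon\mathfrak{M}\to\mathcal{L}(E,F)$ is an i-measure if for any sequence of pairwise disjoint sets $A_n\in\mathfrak{M}$, $\mu(\bigcup_n A_n)x=\sum_n\mu(A_n)x$ for each $x\in E$ and $\sum_n\mu(A_n)$ is independently convergent. Its total semivariation $\|\mu\|_Z$ is the supremum of $\|\sum_{n=1}^N\mu(A_n)x_n\|$ over all finite $N$, pairwise disjoint $A_n\in\mathfrak{M}$ and $x_n\in E$ with $\|x_n\|\le1$; it is known to be finite for every i-measure. $\ell_\infty(Z,E)$ is the space of bounded functions $Z\to E$ with the sup-norm. $M_{\mathfrak{M}}(Z,E)$ is the subspace of all bounded $f\colon Z\to E$ such that $f(Z)$ is separable and $\psi\circ f$ is $\mathfrak{M}$-measurable for each $\psi\in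 E^*$ (a pointwise weak limit of a uniformly bounded sequence from this space again belongs to it). $S_{\mathfrak{M}}(Z,E)$ is the set of $f\in\ell_\infty(Z,E)$ with $f(Z)$ countable and $f^{-1}(\{e\})\in\mathfrak{M}$ for all $e\in E$; for such $f$, $\int_Z f\,\mathrm{d}\mu=\sum_{e\in E}\mu(f^{-1}(\{e\}))e$ (unconditionally convergent). The uniform closure of $S_{\mathfrak{M}}(Z,E)$ is $M_{\mathfrak{M}}(Z,E)$; the map $f\mapsto\int_Zf\,\mathrm{d}\mu$ is linear and continuous on $S_{\mathfrak{M}}(Z,E)$ with norm $\|\mu\|_Z$, and on $M_{\mathfrak{M}}(Z,E)$ the integral is defined as its unique continuous extension. *)

theory Defs
  imports "HOL-Analysis.Analysis"
begin

section \<open>Banach spaces over the field of real or complex numbers\<close>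

text \<open>The scalar field: the real numbers or the complex numbers, with the usual absolute value.
  A type class, so that both cases are covered by one statement.\<close>

class real_or_complex = real_normed_field +
  assumes real_or_complex:
    "(\<forall>z. \<exists>a. z = a *\<^sub>R 1) \<or>
     (\<exists>i. i * i = - 1 \<and> (\<forall>z. \<exists>a b. z = a *\<^sub>R 1 + b *\<^sub>R i) \<and>
          (\<forall>a b. norm (a *\<^sub>R 1 + b *\<^sub>R i) = sqrt (a\<^sup>2 + b\<^sup>2)))"

instance real :: real_or_complex
  by standard auto

instance complex :: real_or_complex
proof
  have "\<exists>a b. z = a *\<^sub>R 1 + b *\<^sub>R \<i>" for z
    by (intro exI[of _ "Re z"] exI[of _ "Im z"]) (simp add: complex_eq_iff)
  moreover have "norm (a *\<^sub>R 1 + b *\<^sub>R \<i>) = sqrt (a\<^sup>2 + b\<^sup>2)" for a b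
    by (simp add: cmod_def)
  ultimately show "(\<forall>z::complex. \<exists>a. z = a *\<^sub>R 1) \<or>
     (\<exists>i::complex. i * i = - 1 \<and> (\<forall>z. \<exists>a b. z = a *\<^sub>R 1 + b *\<^sub>R i) \<and>
          (\<forall>a b. norm (a *\<^sub>R 1 + b *\<^sub>R i) = sqrt (a\<^sup>2 + b\<^sup>2)))"
    by (intro disjI2 exI[of _ "\<i>"]) simp
qed

text \<open>The class \<open>banach\<close> only provides real scalars.  The scalar multiplication by
  \<open>'k\<close> is a parameter, required to extend the real one.\<close>

locale banach_space_over = vector_space scale
  for scale :: "'k::real_or_complex \<Rightarrow> 'e::banach \<Rightarrow> 'e" +
  assumes norm_scale: "norm (scale c x) = norm c * norm x"
    and scale_of_real: "scale (of_real r) x = r *\<^sub>R x"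

lemma banach_space_over_scaleR: "banach_space_over ((*\<^sub>R) :: real \<Rightarrow> 'e::banach \<Rightarrow> 'e)"
  by unfold_locales (simp_all add: algebra_simps)

lemma banach_space_over_times: "banach_space_over ((*) :: 'k \<Rightarrow> 'k \<Rightarrow> 'k::{real_or_complex,banach})"
  by unfold_locales (simp_all add: algebra_simps norm_mult scaleR_conv_of_real)

text \<open>Elements of \<open>'e \<Rightarrow>\<^sub>L 'f\<close> are only real-linear.\<close>

definition operators ::
    "('k::real_or_complex \<Rightarrow> 'e::banach \<Rightarrow> 'e) \<Rightarrow> ('k \<Rightarrow> 'f::banach \<Rightarrow> 'f) \<Rightarrow> ('e \<Rightarrow>\<^sub>L 'f) set" where
  "operators sE sF = {T. Vector_Spaces.linear sE sF (blinfun_apply T)}"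

definition dual_space :: "('k::real_or_complex \<Rightarrow> 'e::banach \<Rightarrow> 'e) \<Rightarrow> ('e \<Rightarrow>\<^sub>L 'k) set" where
  "dual_space sE = {\<psi>. Vector_Spaces.linear sE (*) (blinfun_apply \<psi>)}"

definition weak_topology :: "('k::real_or_complex \<Rightarrow> 'e::banach \<Rightarrow> 'e) \<Rightarrow> 'e topology" where
  "weak_topology sE =
     topology_generated_by {blinfun_apply \<psi> -` U |\<psi> U. \<psi> \<in> dual_space sE \<and> open U}"


section \<open>Operator-valued measures\<close>

definition independently_convergent :: "(nat \<Rightarrow> 'e::banach \<Rightarrow>\<^sub>L 'f::banach) \<Rightarrow> bool" where
  "independently_convergent T \<longleftrightarrow>
     (\<forall>x. bounded (range x) \<longrightarrow> summable (\<lambda>n. blinfun_apply (T n) (x n)))"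

text \<open>Only the values of the set function on members of the \<open>\<sigma>\<close>-algebra are relevant.\<close>

definition i_measure ::
    "('k::real_or_complex \<Rightarrow> 'e::banach \<Rightarrow> 'e) \<Rightarrow> ('k \<Rightarrow> 'f::banach \<Rightarrow> 'f) \<Rightarrow>
     'z set set \<Rightarrow> ('z set \<Rightarrow> 'e \<Rightarrow>\<^sub>L 'f) \<Rightarrow> bool" where
  "i_measure sE sF MM \<mu> \<longleftrightarrow>
     (\<forall>A\<in>MM. \<mu> A \<in> operators sE sF) \<and>
     (\<forall>A::nat \<Rightarrow> 'z set. range A \<subseteq> MM \<and> disjoint_family A \<longrightarrow>
        (\<forall>x. (\<lambda>n. blinfun_apply (\<mu> (A n)) x) sums blinfun_apply (\<mu> (\<Union>n. A n)) x) \<and>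
        independently_convergent (\<lambda>n. \<mu> (A n)))"


section \<open>Function spaces and the integral\<close>

text \<open>A function on \<open>Z\<close> is represented by a function on the whole type \<open>'z\<close> whose values
  outside \<open>Z\<close> are irrelevant.\<close>

definition bounded_functions :: "'z set \<Rightarrow> ('z \<Rightarrow> 'e::banach) set" where
  "bounded_functions Z = {f. bounded (f ` Z)}"

definition M_space ::
    "('k::real_or_complex \<Rightarrow> 'e::banach \<Rightarrow> 'e) \<Rightarrow> 'z set \<Rightarrow> 'z set set \<Rightarrow> ('z \<Rightarrow> 'e) set" where
  "M_space sE Z MM =
     {f \<in> bounded_functions Z. separable_space (top_of_set (f ` Z)) \<and>
        (\<forall>\<psi>\<in>dual_space sE. (\<lambda>z. blinfun_apply \<psi> (f z)) \<in> borel_measurable (sigma Z MM))}"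

definition S_space :: "'z set \<Rightarrow> 'z set set \<Rightarrow> ('z \<Rightarrow> 'e::banach) set" where
  "S_space Z MM =
     {f \<in> bounded_functions Z. countable (f ` Z) \<and> (\<forall>e. f -` {e} \<inter> Z \<in> MM)}"

definition simple_integral ::
    "'z set \<Rightarrow> ('z set \<Rightarrow> 'e::banach \<Rightarrow>\<^sub>L 'f::banach) \<Rightarrow> ('z \<Rightarrow> 'e) \<Rightarrow> 'f" where
  "simple_integral Z \<mu> f = (\<Sum>\<^sub>\<infinity>e. blinfun_apply (\<mu> (f -` {e} \<inter> Z)) e)"

text \<open>Continuity of \<open>I\<close> is with respect to the sup-norm on \<open>Z\<close>.\<close>

definition continuous_extension ::
    "('k::real_or_complex \<Rightarrow> 'e::banach \<Rightarrow> 'e) \<Rightarrow> 'z set \<Rightarrow> 'z set set \<Rightarrow>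
     ('z set \<Rightarrow> 'e \<Rightarrow>\<^sub>L 'f::banach) \<Rightarrow> (('z \<Rightarrow> 'e) \<Rightarrow> 'f) \<Rightarrow> bool" where
  "continuous_extension sE Z MM \<mu> I \<longleftrightarrow>
     (\<forall>f\<in>S_space Z MM. I f = simple_integral Z \<mu> f) \<and>
     (\<forall>f\<in>M_space sE Z MM. \<forall>\<epsilon>>0. \<exists>\<delta>>0. \<forall>g\<in>M_space sE Z MM.
        (\<forall>z\<in>Z. norm (g z - f z) \<le> \<delta>) \<longrightarrow> norm (I g - I f) < \<epsilon>)"

text \<open>The values at members of \<open>M_space\<close> are shared by all continuous extensions, as \<open>S_space\<close>
  is dense there; outside of \<open>M_space\<close> the integral is unspecified.\<close>

definition integral_op ::
    "('k::real_or_complex \<Rightarrow> 'e::banach \<Rightarrow> 'e) \<Rightarrow> 'z set \<Rightarrow> 'z set set \<Rightarrow>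
     ('z set \<Rightarrow> 'e \<Rightarrow>\<^sub>L 'f::banach) \<Rightarrow> ('z \<Rightarrow> 'e) \<Rightarrow> 'f" where
  "integral_op sE Z MM \<mu> f = (THE y. \<exists>I. continuous_extension sE Z MM \<mu> I \<and> I f = y)"

end

theory Submission
  imports Defs
begin

text \<open>
  It suffices to test against real functionals \<open>\<phi>\<close> on \<open>F\<close>, and \<open>\<nu> = \<phi> \<circ> \<mu>\<close> is then an
  i-measure with values in the real dual of \<open>E\<close>. As its values are scalar, the semivariation of
  \<open>\<nu>\<close> is a finite measure \<open>|\<nu>|\<close>. All functions involved take values in the closure of one
  countable rational subspace \<open>D\<close> (the weak limit too, by Hahn-Banach). The Radon-Nikodym
  densities of \<open>A \<mapsto> \<nu> A d\<close> for \<open>d \<in> D\<close> are, off a common null set, rationally linear in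
  \<open>d\<close> and bounded by \<open>\<parallel>d\<parallel>\<close>, hence given by functionals \<open>l\<^sub>z\<close> of norm at most 1. This yields
  \<open>\<phi> (\<integral> f d\<mu>) = \<integral> l\<^sub>z (f z) d|\<nu>|(z)\<close>, and the claim follows by dominated convergence.
\<close>

section \<open>The Hahn-Banach theorem\<close>

text \<open>The semivariation of a measure with values in a Banach space is in general only
  subadditive, so it offers no integral for a dominated convergence argument. Scalar values change
  this: vectors on disjoint sets can be multiplied by signs independently, which makes all
  contributions nonnegative. Finiteness of the resulting measure matters because the dominating
  function is a constant; it rests on independent convergence, that is, on the freedom to choose a
  different vector on each set. The dual of \<open>E\<close> may fail the Radon-Nikodym property and
  \<open>E\<close> need not be separable, so a strongly measurable density cannot be expected. The
  functionals \<open>l z\<close> are therefore chosen point by point, and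
  \<open>z \<mapsto> l z d\<close> is controlled only for \<open>d\<close> in the countable set
  \<open>D\<close>. Measurability of \<open>z \<mapsto> l z (f z)\<close> then comes from uniform
  approximation of \<open>f\<close> by countably valued functions with values in \<open>D\<close>,
  which is why a single \<open>D\<close> has to serve the whole sequence and its limit.\<close>

definition sublinear :: "('a::real_vector \<Rightarrow> real) \<Rightarrow> bool" where
  "sublinear p \<longleftrightarrow> (\<forall>x y. p (x + y) \<le> p x + p y) \<and> (\<forall>t\<ge>0. \<forall>x. p (t *\<^sub>R x) = t * p x)"

text \<open>Applying the scaling inequality to \<open>inverse t\<close> and
  \<open>t *\<^sub>R x\<close> gives its converse, so one direction for positive \<open>t\<close>
  suffices.\<close>

lemma sublinearI:
  assumes "\<And>x y. p (x + y) \<le> p x + p y" and "p 0 = 0" and "\<And>t x. t > 0 \<Longrightarrow> p (t *\<^sub>R x) \<le> t * p x"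
  shows "sublinear p"
  unfolding sublinear_def
proof (intro conjI allI impI)
  fix t x assume t: "0 \<le> (t::real)"
  show "p (t *\<^sub>R x) = t * p x"
  proof (cases "t = 0")
    case False
    with t have t: "t > 0" by simp
    have "p (inverse t *\<^sub>R t *\<^sub>R x) \<le> inverse t * p (t *\<^sub>R x)"
      using t by (intro assms(3)) simp
    with t have "t * p x \<le> p (t *\<^sub>R x)" by (simp add: field_simps)
    with assms(3)[OF t, of x] show ?thesis by simp
  qed (simp add: assms(2))
qed (rule assms(1))

lemma sublinearD:
  assumes "sublinear p"
  shows "p (x + y) \<le> p x + p y" and "t \<ge> 0 \<Longrightarrow> p (t *\<^sub>R x) = t * p x" and "p 0 = 0"
    and "- p (- x) \<le> p x"
proof -
  show a: "p (x + y) \<le> p x + p y" for x y using assms by (simp add: sublinear_def)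
  show b: "t \<ge> 0 \<Longrightarrow> p (t *\<^sub>R x) = t * p x" for t x using assms by (simp add: sublinear_def)
  show z: "p 0 = 0" using b[of 0 0] by simp
  show "- p (- x) \<le> p x" using a[of x "- x"] z by simp
qed

text \<open>Zorn's lemma for the reversed pointwise order. A chain is bounded by its pointwise
  infimum, which is finite because every sublinear \<open>q \<le> p\<close> satisfies
  \<open>- p (- x) \<le> q x\<close>.\<close>

lemma minimal_sublinear_exists:
  fixes p :: "'a::real_vector \<Rightarrow> real"
  assumes p: "sublinear p"
  obtains q where "sublinear q" and "q \<le> p" and "\<And>q'. sublinear q' \<Longrightarrow> q' \<le> q \<Longrightarrow> q' = q"
proof -
  define A where "A = {q. sublinear q \<and> q \<le> p}"
  define P where "P = (\<lambda>a b :: 'a \<Rightarrow> real. b \<le> a)"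
  have po: "partial_order_on A (relation_of P A)"
    by (rule partial_order_on_relation_ofI) (auto simp: P_def)
  have "\<exists>u\<in>A. \<forall>a\<in>C. P a u" if C: "C \<in> Chains (relation_of P A)" for C
  proof (cases "C = {}")
    case True
    with p show ?thesis by (auto simp: A_def)
  next
    case False
    have CA: "q \<in> A" if "q \<in> C" for q
      using C that by (auto simp: Chains_def relation_of_def)
    have tot: "q \<le> q' \<or> q' \<le> q" if "q \<in> C" "q' \<in> C" for q q'
      using C that by (auto simp: Chains_def relation_of_def P_def)
    have sub: "sublinear q" if "q \<in> C" for q using CA[OF that] by (simp add: A_def)
    have lep: "q x \<le> p x" if "q \<in> C" for q x using CA[OF that] by (simp add: A_def le_fun_def)
    have lb: "- p (- x) \<le> q x" if "q \<in> C" for q x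
      using lep[OF that, of "- x"] sublinearD(4)[OF sub[OF that], of x] by linarith
    have bdd: "bdd_below ((\<lambda>q. q x) ` C)" for x
      using lb by (auto intro!: bdd_belowI)
    define u where "u = (\<lambda>x. INF q\<in>C. q x)"
    have u_le: "u x \<le> q x" if "q \<in> C" for q x
      unfolding u_def using bdd that by (rule cINF_lower)
    have u_ge: "c \<le> u x" if "\<And>q. q \<in> C \<Longrightarrow> c \<le> q x" for c x
      unfolding u_def using False that by (intro cINF_greatest) auto
    have "sublinear u"
    proof (rule sublinearI)
      obtain q where "q \<in> C" using False by blast
      with u_le[of q 0] u_ge[of 0 0] show "u 0 = 0" using sublinearD(3)[OF sub] by fastforce
      show "u (t *\<^sub>R x) \<le> t * u x" if "t > 0" for t x
      proof -
        have "u (t *\<^sub>R x) / t \<le> u x"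
        proof (rule u_ge)
          fix q assume "q \<in> C"
          from u_le[OF this, of "t *\<^sub>R x"] sublinearD(2)[OF sub[OF this], of t x] that
          show "u (t *\<^sub>R x) / t \<le> q x" by (simp add: field_simps)
        qed
        with that show ?thesis by (simp add: field_simps)
      qed
      show "u (x + y) \<le> u x + u y" for x y
      proof -
        have "u (x + y) \<le> q x + q' y" if q: "q \<in> C" "q' \<in> C" for q q'
        proof -
          \<comment> \<open>In a chain the smaller of \<open>q\<close> and \<open>q'\<close> bounds
            both, so subadditivity of a single member covers independent choices in the two
            infima.\<close>
          obtain r where r: "r \<in> C" "r \<le> q" "r \<le> q'" using tot[OF q] q by blast
          have "u (x + y) \<le> r (x + y)" by (rule u_le) fact
          also have "\<dots> \<le> r x + r y" by (rule sublinearD(1)[OF sub]) fact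
          also have "\<dots> \<le> q x + q' y" using r by (intro add_mono) (auto simp: le_fun_def)
          finally show ?thesis .
        qed
        then have "u (x + y) - q' y \<le> u x" if "q' \<in> C" for q'
          using that by (intro u_ge) (simp add: diff_le_eq)
        then have "u (x + y) - u x \<le> u y" by (intro u_ge) (simp add: algebra_simps)
        then show ?thesis by simp
      qed
    qed
    moreover obtain q where "q \<in> C" using False by blast
    moreover from this have "u x \<le> p x" for x using u_le[of q x] lep[of q x] by linarith
    ultimately have "u \<in> A" by (simp add: A_def le_fun_def)
    with u_le show ?thesis by (auto simp: P_def le_fun_def)
  qed
  from predicate_Zorn[OF po this] obtain q where q: "q \<in> A" "\<And>a. a \<in> A \<Longrightarrow> P q a \<Longrightarrow> a = q"
    by blast
  show thesis
    by (rule that[of q]) (use q in \<open>auto simp: A_def P_def intro: order_trans\<close>)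
qed

text \<open>A minimal sublinear functional \<open>q\<close> is linear: lowering it in the direction \<open>a\<close> to
  \<open>x \<mapsto> inf\<^sub>t (q (x + t a) - t q a)\<close> cannot change it. The same lowering applied to \<open>p\<close>
  first makes the value at \<open>a\<close> extremal.\<close>

definition lower_along :: "('a::real_vector \<Rightarrow> real) \<Rightarrow> 'a \<Rightarrow> 'a \<Rightarrow> real" where
  "lower_along p a x = (INF t\<in>{0..}. p (x + t *\<^sub>R a) - t * p a)"

lemma lower_along_le:
  assumes p: "sublinear p" and t: "t \<ge> 0"
  shows "lower_along p a x \<le> p (x + t *\<^sub>R a) - t * p a"
proof -
  have "- p (- x) \<le> p (x + t *\<^sub>R a) - t * p a" if "t \<ge> 0" for t
    using sublinearD(1)[OF p, of "x + t *\<^sub>R a" "- x"] sublinearD(2)[OF p that, of a] by simp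
  then have "bdd_below ((\<lambda>t. p (x + t *\<^sub>R a) - t * p a) ` {0..})"
    by (auto intro!: bdd_belowI)
  with t show ?thesis unfolding lower_along_def by (intro cINF_lower) auto
qed

lemma lower_along_greatest:
  "(\<And>t. t \<ge> 0 \<Longrightarrow> c \<le> p (x + t *\<^sub>R a) - t * p a) \<Longrightarrow> c \<le> lower_along p a x"
  unfolding lower_along_def by (rule cINF_greatest) auto

lemma lower_along_sublinear:
  assumes p: "sublinear p"
  shows "sublinear (lower_along p a)"
proof (rule sublinearI)
  let ?l = "lower_along p a"
  show "?l 0 = 0"
    using lower_along_le[OF p order_refl, of a 0] sublinearD(3)[OF p]
    by (intro antisym lower_along_greatest) (auto simp: sublinearD(2)[OF p])
  show "?l (s *\<^sub>R x) \<le> s * ?l x" if s: "s > 0" for s x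
  proof -
    have "?l (s *\<^sub>R x) / s \<le> ?l x"
    proof (rule lower_along_greatest)
      fix t :: real assume t: "t \<ge> 0"
      have "?l (s *\<^sub>R x) \<le> p (s *\<^sub>R x + (s * t) *\<^sub>R a) - s * t * p a"
        using s t by (intro lower_along_le[OF p]) simp
      also have "s *\<^sub>R x + (s * t) *\<^sub>R a = s *\<^sub>R (x + t *\<^sub>R a)" by (simp add: algebra_simps)
      also have "p \<dots> = s * p (x + t *\<^sub>R a)" using s by (simp add: sublinearD(2)[OF p])
      finally show "?l (s *\<^sub>R x) / s \<le> p (x + t *\<^sub>R a) - t * p a"
        using s by (simp add: field_simps)
    qed
    with s show ?thesis by (simp add: field_simps)
  qed
  show "?l (x + y) \<le> ?l x + ?l y" for x y
  proof -
    have *: "?l (x + y) \<le> (p (x + t *\<^sub>R a) - t * p a) + (p (y + s *\<^sub>R a) - s * p a)"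
      if "t \<ge> 0" "s \<ge> 0" for t s
    proof -
      have "?l (x + y) \<le> p (x + y + (t + s) *\<^sub>R a) - (t + s) * p a"
        using that by (intro lower_along_le[OF p]) simp
      also have "x + y + (t + s) *\<^sub>R a = (x + t *\<^sub>R a) + (y + s *\<^sub>R a)" by (simp add: algebra_simps)
      finally show ?thesis
        using sublinearD(1)[OF p, of "x + t *\<^sub>R a" "y + s *\<^sub>R a"] by (simp add: algebra_simps)
    qed
    have "?l (x + y) - (p (y + s *\<^sub>R a) - s * p a) \<le> ?l x" if "s \<ge> 0" for s
    proof (rule lower_along_greatest)
      fix t :: real assume "t \<ge> 0"
      from *[OF this that] show "?l (x + y) - (p (y + s *\<^sub>R a) - s * p a) \<le> p (x + t *\<^sub>R a) - t * p a"
        by linarith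
    qed
    then have "?l (x + y) - ?l x \<le> ?l y"
      by (intro lower_along_greatest) (simp add: algebra_simps)
    then show ?thesis by simp
  qed
qed

lemma Hahn_Banach_sublinear:
  fixes p :: "'a::real_vector \<Rightarrow> real"
  assumes p: "sublinear p"
  obtains l where "linear l" and "\<And>x. l x \<le> p x" and "l a = p a"
proof -
  obtain q where q: "sublinear q" "q \<le> lower_along p a"
    and min: "\<And>q'. sublinear q' \<Longrightarrow> q' \<le> q \<Longrightarrow> q' = q"
    using minimal_sublinear_exists[OF lower_along_sublinear[OF p]] by blast
  have qp: "q x \<le> p x" for x
    using lower_along_le[OF p, of 0 a x] q(2) by (auto simp: le_fun_def intro: order_trans)
  have lower: "lower_along q b = q" for b
    using lower_along_le[OF q(1), of 0 b]
    by (intro min lower_along_sublinear q) (auto simp: le_fun_def)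
  \<comment> \<open>With \<open>t = 1\<close>, invariance under lowering along \<open>y\<close>
    reads \<open>q x \<le> q (x + y) - q y\<close>, the half of additivity that subadditivity does
    not give.\<close>
  have add: "q (x + y) = q x + q y" for x y
    using lower_along_le[OF q(1), of 1 y x] sublinearD(1)[OF q(1), of x y] by (simp add: lower)
  have neg: "q (- x) = - q x" for x
    using add[of x "- x"] sublinearD(3)[OF q(1)] by simp
  have "linear q"
  proof (rule linearI)
    show "q (t *\<^sub>R x) = t *\<^sub>R q x" for t x
    proof (cases "t \<ge> 0")
      case False
      then have "q ((- t) *\<^sub>R (- x)) = (- t) * q (- x)" by (intro sublinearD(2)[OF q(1)]) simp
      then show ?thesis by (simp add: neg)
    qed (simp add: sublinearD(2)[OF q(1)])
  qed (rule add)
  moreover have "q a = p a"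
  proof (rule antisym)
    \<comment> \<open>The choice \<open>t = 1\<close> moves \<open>- a\<close> to 0, where
      \<open>p\<close> vanishes; this leaves \<open>q (- a) \<le> - p a\<close>.\<close>
    have "q (- a) \<le> lower_along p a (- a)" using q(2) by (simp add: le_fun_def)
    also have "\<dots> \<le> p (- a + 1 *\<^sub>R a) - 1 * p a" by (rule lower_along_le[OF p]) simp
    finally show "p a \<le> q a" using sublinearD(3)[OF p] by (simp add: neg)
  qed (rule qp)
  ultimately show thesis using qp that by blast
qed

lemma blinfun_of_linear_le_norm:
  fixes l :: "'a::real_normed_vector \<Rightarrow> real"
  assumes "linear l" and "\<And>x. l x \<le> norm x"
  obtains L where "blinfun_apply L = l" and "norm L \<le> 1"
proof -
  have b: "\<bar>l x\<bar> \<le> norm x" for x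
    using assms(2)[of x] assms(2)[of "- x"] linear_neg[OF assms(1), of x] by (auto simp: abs_le_iff)
  then have "bounded_linear l"
    using assms(1) by (intro bounded_linear_intro[of l 1]) (auto simp: linear_add linear_cmul)
  then have eq: "blinfun_apply (Blinfun l) = l" by (rule bounded_linear_Blinfun_apply)
  moreover have "norm (Blinfun l) \<le> 1"
    using b by (intro norm_blinfun_bound) (auto simp: eq)
  ultimately show thesis by (rule that)
qed

lemma sublinear_norm: "sublinear (norm :: 'a::real_normed_vector \<Rightarrow> real)"
  by (rule sublinearI) (auto intro: norm_triangle_ineq)

lemma norming_functional:
  fixes a :: "'a::real_normed_vector"
  obtains L :: "'a \<Rightarrow>\<^sub>L real" where "norm L \<le> 1" and "L a = norm a"
proof -
  obtain l where l: "linear l" "\<And>x. l x \<le> norm x" "l a = norm a"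
    using Hahn_Banach_sublinear[OF sublinear_norm, of a] by blast
  obtain L where "blinfun_apply L = l" "norm L \<le> 1" using blinfun_of_linear_le_norm[OF l(1,2)] .
  with l(3) show thesis by (intro that[of L]) auto
qed

section \<open>Rational subspaces and extension of rationally linear functionals\<close>

text \<open>Rational coefficients keep the span of a countable set countable, so that
  almost-everywhere identities for its members share one null set. The closure of such a set is
  nevertheless a real subspace.\<close>

definition rational_subspace :: "'a::real_vector set \<Rightarrow> bool" where
  "rational_subspace D \<longleftrightarrow> 0 \<in> D \<and> (\<forall>x\<in>D. \<forall>y\<in>D. \<forall>q\<in>\<rat>. x + q *\<^sub>R y \<in> D)"

lemma rational_subspaceD:
  assumes "rational_subspace D"
  shows "0 \<in> D" and "x \<in> D \<Longrightarrow> y \<in> D \<Longrightarrow> x + y \<in> D" and "q \<in> \<rat> \<Longrightarrow> x \<in> D \<Longrightarrow> q *\<^sub>R x \<in> D"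
proof -
  have D: "0 \<in> D" "\<And>x y q. x \<in> D \<Longrightarrow> y \<in> D \<Longrightarrow> q \<in> \<rat> \<Longrightarrow> x + q *\<^sub>R y \<in> D"
    using assms by (auto simp: rational_subspace_def)
  show "0 \<in> D" by fact
  show "x \<in> D \<Longrightarrow> y \<in> D \<Longrightarrow> x + y \<in> D" using D(2)[of x y 1] by simp
  show "q \<in> \<rat> \<Longrightarrow> x \<in> D \<Longrightarrow> q *\<^sub>R x \<in> D" using D(2)[of 0 x q] D(1) by simp
qed

text \<open>Finite formal combinations are encoded as lists of coefficient-vector pairs: appending
  lists adds their values, and there are only countably many lists.\<close>

lemma countable_rational_subspace:
  assumes "countable (B :: 'a::real_vector set)"
  obtains D where "countable D" and "rational_subspace D" and "B \<subseteq> D"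
proof -
  define c where "c xs = sum_list (map (\<lambda>(q, b). q *\<^sub>R b) xs)" for xs :: "(real \<times> 'a) list"
  define D where "D = c ` lists (\<rat> \<times> B)"
  have "countable D"
    unfolding D_def using assms countable_rat by (intro countable_image countable_lists countable_SIGMA)
  moreover have "rational_subspace D"
    unfolding rational_subspace_def
  proof (intro conjI ballI)
    show "0 \<in> D" unfolding D_def by (rule image_eqI[of _ _ "[]"]) (auto simp: c_def)
    fix x y and q :: real assume "x \<in> D" "y \<in> D" "q \<in> \<rat>"
    then obtain xs ys where xs: "x = c xs" "xs \<in> lists (\<rat> \<times> B)" and ys: "y = c ys" "ys \<in> lists (\<rat> \<times> B)"
      by (auto simp: D_def)
    let ?ys = "map (\<lambda>(r, b). (q * r, b)) ys"
    have "c ?ys = q *\<^sub>R c ys" by (induction ys) (auto simp: c_def algebra_simps)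
    then have "x + q *\<^sub>R y = c (xs @ ?ys)" by (simp add: xs ys c_def)
    moreover have "xs @ ?ys \<in> lists (\<rat> \<times> B)" using xs ys \<open>q \<in> \<rat>\<close> by (auto intro!: Rats_mult)
    ultimately show "x + q *\<^sub>R y \<in> D" unfolding D_def by blast
  qed
  moreover have "B \<subseteq> D"
  proof
    fix b assume "b \<in> B"
    then show "b \<in> D" unfolding D_def by (intro image_eqI[of _ _ "[(1, b)]"]) (auto simp: c_def)
  qed
  ultimately show thesis by (rule that)
qed

text \<open>Subadditivity and \<open>p \<le> norm\<close> make \<open>p\<close> 1-Lipschitz, which
  carries homogeneity from rational factors to real ones.\<close>

lemma sublinearI_rational:
  fixes p :: "'a::real_normed_vector \<Rightarrow> real"
  assumes add: "\<And>x y. p (x + y) \<le> p x + p y" and le: "\<And>x. p x \<le> norm x" and "p 0 = 0"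
    and rat: "\<And>q x. q \<in> \<rat> \<Longrightarrow> q > 0 \<Longrightarrow> p (q *\<^sub>R x) \<le> q * p x"
  shows "sublinear p"
proof (rule sublinearI)
  have lip: "p x \<le> p y + norm (x - y)" for x y
    using add[of y "x - y"] le[of "x - y"] by simp
  fix t :: real and x assume t: "t > 0"
  show "p (t *\<^sub>R x) \<le> t * p x"
  proof (rule field_le_epsilon)
    fix e :: real assume e: "e > 0"
    \<comment> \<open>Replacing \<open>t\<close> by a rational \<open>q\<close> between
      \<open>t\<close> and \<open>t + d\<close> costs at most
      \<open>(q - t) * (\<bar>p x\<bar> + norm x)\<close>; \<open>d\<close> keeps this at most
      \<open>e\<close>, and the summand 1 keeps the denominator positive.\<close>
    define d where "d = e / (\<bar>p x\<bar> + norm x + 1)"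
    have c: "\<bar>p x\<bar> + norm x + 1 > 0" by (simp add: add_nonneg_pos)
    with e have d: "d > 0" by (simp add: d_def)
    have "d * (\<bar>p x\<bar> + norm x) \<le> d * (\<bar>p x\<bar> + norm x + 1)" using d by (intro mult_left_mono) auto
    also have "\<dots> = e" using c by (simp add: d_def)
    finally have d': "d * (\<bar>p x\<bar> + norm x) \<le> e" .
    obtain q where q: "q \<in> \<rat>" "t < q" "q < t + d" using Rats_dense_in_real[of t "t + d"] d by auto
    have "p (t *\<^sub>R x) \<le> p (q *\<^sub>R x) + norm (t *\<^sub>R x - q *\<^sub>R x)" by (rule lip)
    also have "norm (t *\<^sub>R x - q *\<^sub>R x) = (q - t) * norm x"
      using q by (simp flip: scaleR_left_diff_distrib)
    also have "p (q *\<^sub>R x) \<le> q * p x" using q t by (intro rat) auto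
    also have "q * p x = t * p x + (q - t) * p x" by (simp add: algebra_simps)
    also have "(q - t) * p x \<le> (q - t) * \<bar>p x\<bar>" using q by (intro mult_left_mono) auto
    finally have "p (t *\<^sub>R x) \<le> t * p x + (q - t) * (\<bar>p x\<bar> + norm x)" by (simp add: algebra_simps)
    also have "(q - t) * (\<bar>p x\<bar> + norm x) \<le> d * (\<bar>p x\<bar> + norm x)"
      using q by (intro mult_right_mono) auto
    finally show "p (t *\<^sub>R x) \<le> t * p x + e" using d' by simp
  qed
qed fact+

text \<open>The infimal convolution of \<open>h\<close> on \<open>D\<close> with the norm: the
  largest sublinear functional lying below \<open>norm\<close> everywhere and below \<open>h\<close>
  on \<open>D\<close>. It is finite since \<open>h \<le> norm\<close> on the symmetric set
  \<open>D\<close> also yields \<open>- norm d \<le> h d\<close>.\<close>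

lemma sublinear_extension:
  fixes D :: "'a::real_normed_vector set"
  assumes D: "rational_subspace D"
    and lin: "\<And>x y q. x \<in> D \<Longrightarrow> y \<in> D \<Longrightarrow> q \<in> \<rat> \<Longrightarrow> h (x + q *\<^sub>R y) = h x + q * h y"
    and le: "\<And>x. x \<in> D \<Longrightarrow> h x \<le> norm x"
  shows "sublinear (\<lambda>x. INF d\<in>D. h d + norm (x - d))" (is "sublinear ?p")
    and "d \<in> D \<Longrightarrow> (INF d\<in>D. h d + norm (x - d)) \<le> h d + norm (x - d)"
proof -
  note D' = rational_subspaceD[OF D]
  have h0: "h 0 = 0" using lin[of 0 0 1] D' by simp
  have hadd: "h (x + y) = h x + h y" if "x \<in> D" "y \<in> D" for x y using lin[of x y 1] that by simp
  have hmult: "h (q *\<^sub>R x) = q * h x" if "x \<in> D" "q \<in> \<rat>" for x q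
    using lin[of 0 x q] that h0 D' by simp
  have lb: "- norm x \<le> h d + norm (x - d)" if "d \<in> D" for x d
  proof -
    have m: "(-1) *\<^sub>R d \<in> D" using that by (intro D') auto
    have "- h d = h ((-1) *\<^sub>R d)" using that by (subst hmult) auto
    also have "\<dots> \<le> norm d" using le[OF m] by simp
    also have "norm d \<le> norm x + norm (x - d)" using norm_triangle_ineq4[of x "x - d"] by simp
    finally show ?thesis by simp
  qed
  then have bdd: "bdd_below ((\<lambda>d. h d + norm (x - d)) ` D)" for x
    by (auto intro!: bdd_belowI)
  show p_le: "?p x \<le> h d + norm (x - d)" if "d \<in> D" for x d
    using bdd that by (rule cINF_lower)
  have p_ge: "c \<le> ?p x" if "\<And>d. d \<in> D \<Longrightarrow> c \<le> h d + norm (x - d)" for c x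
    using D'(1) that by (intro cINF_greatest) auto
  show "sublinear ?p"
  proof (rule sublinearI_rational)
    show "?p x \<le> norm x" for x using p_le[OF D'(1), of x] h0 by simp
    show "?p 0 = 0" using p_le[OF D'(1), of 0] h0 lb[of _ 0] by (intro antisym p_ge) auto
    show "?p (x + y) \<le> ?p x + ?p y" for x y
    proof -
      have *: "?p (x + y) \<le> (h d + norm (x - d)) + (h e + norm (y - e))" if "d \<in> D" "e \<in> D" for d e
      proof -
        have "?p (x + y) \<le> h (d + e) + norm (x + y - (d + e))" using that by (intro p_le D')
        also have "norm (x + y - (d + e)) \<le> norm (x - d) + norm (y - e)"
          by (rule norm_diff_triangle_ineq)
        finally show ?thesis using hadd[OF that] by simp
      qed
      have "?p (x + y) - (h e + norm (y - e)) \<le> ?p x" if "e \<in> D" for e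
      proof (rule p_ge)
        fix d assume "d \<in> D"
        from *[OF this that] show "?p (x + y) - (h e + norm (y - e)) \<le> h d + norm (x - d)" by linarith
      qed
      then have "?p (x + y) - ?p x \<le> ?p y"
        by (intro p_ge) (simp add: algebra_simps)
      then show ?thesis by simp
    qed
    show "?p (q *\<^sub>R x) \<le> q * ?p x" if q: "q \<in> \<rat>" "q > 0" for q x
    proof -
      have "?p (q *\<^sub>R x) / q \<le> ?p x"
      proof (rule p_ge)
        fix d assume d: "d \<in> D"
        have "?p (q *\<^sub>R x) \<le> h (q *\<^sub>R d) + norm (q *\<^sub>R x - q *\<^sub>R d)" using d q by (intro p_le D')
        also have "\<dots> = q * (h d + norm (x - d))"
          using d q by (simp add: hmult algebra_simps flip: scaleR_right_diff_distrib)
        finally show "?p (q *\<^sub>R x) / q \<le> h d + norm (x - d)" using q by (simp add: field_simps)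
      qed
      with q show ?thesis by (simp add: field_simps)
    qed
  qed
qed

text \<open>In the infimum that dominates \<open>l\<close>, the choice \<open>d = 0\<close> gives
  \<open>l \<le> norm\<close> and \<open>d = x\<close> gives \<open>l x \<le> h x\<close>; replacing
  \<open>x\<close> by \<open>- x\<close> turns the latter into an equality. While \<open>h\<close>
  is only rationally linear on \<open>D\<close>, \<open>l\<close> is linear over the reals.\<close>

lemma Hahn_Banach_rational_subspace:
  fixes D :: "'a::real_normed_vector set"
  assumes D: "rational_subspace D"
    and lin: "\<And>x y q. x \<in> D \<Longrightarrow> y \<in> D \<Longrightarrow> q \<in> \<rat> \<Longrightarrow> h (x + q *\<^sub>R y) = h x + q * h y"
    and le: "\<And>x. x \<in> D \<Longrightarrow> h x \<le> norm x"
  obtains L :: "'a \<Rightarrow>\<^sub>L real" where "norm L \<le> 1" and "\<And>x. x \<in> D \<Longrightarrow> L x = h x"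
proof -
  note D' = rational_subspaceD[OF D]
  let ?p = "\<lambda>x. INF d\<in>D. h d + norm (x - d)"
  have p: "sublinear ?p" "\<And>x d. d \<in> D \<Longrightarrow> ?p x \<le> h d + norm (x - d)"
    using sublinear_extension[OF D, of h] lin le by auto
  have h0: "h 0 = 0" using lin[of 0 0 1] D' by simp
  obtain l where l: "linear l" "\<And>x. l x \<le> ?p x" using Hahn_Banach_sublinear[OF p(1)] by blast
  have ln: "l x \<le> norm x" for x using l(2)[of x] p(2)[OF D'(1), of x] h0 by simp
  obtain L where L: "blinfun_apply L = l" "norm L \<le> 1" using blinfun_of_linear_le_norm[OF l(1) ln] .
  have lh: "l x \<le> h x" if "x \<in> D" for x using l(2)[of x] p(2)[OF that, of x] by simp
  have "l x = h x" if "x \<in> D" for x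
  proof (rule antisym)
    have "- x \<in> D" using D'(3)[of "-1" x] that by simp
    then have "l (- x) \<le> h (- x)" by (rule lh)
    also have "h (- x) = - h x" using lin[of 0 x "-1"] that D' h0 by simp
    finally show "h x \<le> l x" using linear_neg[OF l(1)] by simp
  qed (rule lh[OF that])
  with L show thesis by (intro that[of L]) auto
qed

text \<open>For \<open>h = 0\<close> the dominating sublinear functional is the distance to
  \<open>D\<close>, positive at \<open>a\<close>. Attaining it at \<open>a\<close> keeps the linear
  functional from vanishing there.\<close>

lemma separating_functional:
  fixes D :: "'a::real_normed_vector set"
  assumes D: "rational_subspace D" and a: "a \<notin> closure D"
  obtains L :: "'a \<Rightarrow>\<^sub>L real" where "\<And>x. x \<in> D \<Longrightarrow> L x = 0" and "L a \<noteq> 0"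
proof -
  note D' = rational_subspaceD[OF D]
  let ?p = "\<lambda>x. INF d\<in>D. 0 + norm (x - d)"
  have p: "sublinear ?p" "\<And>x d. d \<in> D \<Longrightarrow> ?p x \<le> 0 + norm (x - d)"
    using sublinear_extension[OF D, of "\<lambda>_. 0"] by auto
  obtain l where l: "linear l" "\<And>x. l x \<le> ?p x" "l a = ?p a" using Hahn_Banach_sublinear[OF p(1), of a] by blast
  have ln: "l x \<le> norm x" for x using l(2)[of x] p(2)[OF D'(1), of x] by simp
  obtain L where L: "blinfun_apply L = l" using blinfun_of_linear_le_norm[OF l(1) ln] .
  have l0: "l x \<le> 0" if "x \<in> D" for x using l(2)[of x] p(2)[OF that, of x] by simp
  have "l x = 0" if "x \<in> D" for x
    using l0[OF that] l0[of "- x"] D'(3)[of "-1" x] that linear_neg[OF l(1), of x] by simp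
  moreover have "l a \<noteq> 0"
  proof -
    have "?p a = infdist a D" using D'(1) by (subst infdist_notempty) (auto simp: dist_norm)
    also have "\<dots> \<noteq> 0" using in_closure_iff_infdist_zero[of D a] a D'(1) by auto
    finally show ?thesis using l(3) by simp
  qed
  ultimately show thesis using L by (intro that[of L]) auto
qed

section \<open>Weak convergence and real functionals\<close>

text \<open>Abstract scalars come without a real part, so \<open>r\<close> is obtained as a
  functional of norm at most 1 with value 1 at the unit. In the complex case the last formula
  recovers \<open>z\<close> from the real parts of \<open>z\<close> and
  \<open>i * z\<close>.\<close>

lemma real_part_exists:
  obtains r :: "'k::real_or_complex \<Rightarrow>\<^sub>L real" where "r 1 = 1"
    and "(\<forall>z. r z *\<^sub>R 1 = z) \<or> (\<exists>i. i * i = - 1 \<and> r i = 0 \<and> (\<forall>z. r z *\<^sub>R 1 - r (i * z) *\<^sub>R i = z))"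
proof -
  obtain r :: "'k \<Rightarrow>\<^sub>L real" where r: "norm r \<le> 1" "r 1 = norm (1::'k)" by (rule norming_functional)
  then have r1: "r 1 = 1" by simp
  have le: "r z \<le> norm z" for z
  proof -
    have "r z \<le> norm (r z)" by simp
    also have "\<dots> \<le> norm r * norm z" by (rule norm_blinfun)
    also have "\<dots> \<le> norm z" using r(1) by (simp add: mult_left_le_one_le)
    finally show ?thesis .
  qed
  from real_or_complex[where 'a='k]
  have "(\<forall>z. r z *\<^sub>R 1 = z) \<or> (\<exists>i. i * i = - 1 \<and> r i = 0 \<and> (\<forall>z. r z *\<^sub>R 1 - r (i * z) *\<^sub>R i = z))"
  proof (elim disjE exE conjE)
    assume a: "\<forall>z::'k. \<exists>a. z = a *\<^sub>R 1"
    have "r z *\<^sub>R 1 = z" for z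
    proof -
      from a obtain a where "z = a *\<^sub>R 1" by blast
      then show ?thesis by (simp add: blinfun.scaleR_right r1)
    qed
    then show ?thesis by blast
  next
    fix i :: 'k
    assume i: "i * i = - 1" and ab: "\<forall>z. \<exists>a b. z = a *\<^sub>R 1 + b *\<^sub>R i"
      and nrm: "\<forall>a b. norm (a *\<^sub>R 1 + b *\<^sub>R i) = sqrt (a\<^sup>2 + b\<^sup>2)"
    \<comment> \<open>Testing \<open>r \<le> norm\<close> at \<open>1 + c i\<close> gives
      \<open>1 + c\<^sup>2 \<le> sqrt (1 + c\<^sup>2)\<close>, which forces
      \<open>c = 0\<close>.\<close>
    define c where "c = r i"
    have "norm (1 *\<^sub>R 1 + c *\<^sub>R i) = sqrt (1\<^sup>2 + c\<^sup>2)" using nrm by blast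
    moreover have "r (1 *\<^sub>R 1 + c *\<^sub>R i) = 1 + c * c"
      by (simp add: blinfun.add_right blinfun.scaleR_right r1 c_def)
    ultimately have "1 + c * c \<le> sqrt (1\<^sup>2 + c\<^sup>2)" using le[of "1 *\<^sub>R 1 + c *\<^sub>R i"] by linarith
    then have "(1 + c * c)\<^sup>2 \<le> (sqrt (1\<^sup>2 + c\<^sup>2))\<^sup>2" by (intro power_mono) auto
    then have "(1 + c * c)\<^sup>2 \<le> 1 + c * c" by (simp add: power2_eq_square)
    then have "c * c + (c * c)\<^sup>2 \<le> 0" by (simp add: power2_eq_square algebra_simps)
    moreover have "0 \<le> (c * c)\<^sup>2" "0 \<le> c * c" by simp_all
    ultimately have "c * c = 0" by linarith
    then have c0: "r i = 0" by (simp add: c_def)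
    have "r z *\<^sub>R 1 - r (i * z) *\<^sub>R i = z" for z
    proof -
      obtain a b where z: "z = a *\<^sub>R 1 + b *\<^sub>R i" using ab by blast
      then have "i * z = a *\<^sub>R i - b *\<^sub>R 1" using i by (simp add: algebra_simps)
      then have "r z = a" "r (i * z) = - b"
        using z by (simp_all add: blinfun.add_right blinfun.diff_right blinfun.scaleR_right r1 c0)
      with z show ?thesis by simp
    qed
    with i c0 show ?thesis by blast
  qed
  with r1 show thesis by (rule that)
qed

text \<open>The Bohnenblust-Sobczyk formula \<open>\<Psi> x = \<psi> x - i \<psi> (i x)\<close>
  complexifies a real functional; over the reals, the values of \<open>\<psi>\<close> are just read
  as multiples of 1.\<close>

lemma real_functional_extends:
  fixes sE :: "'k::real_or_complex \<Rightarrow> 'e::banach \<Rightarrow> 'e" and \<psi> :: "'e \<Rightarrow>\<^sub>L real"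
  assumes "banach_space_over sE"
  obtains \<Psi> and r :: "'k \<Rightarrow>\<^sub>L real" where "\<Psi> \<in> dual_space sE" and "\<And>x. r (blinfun_apply \<Psi> x) = \<psi> x"
proof -
  interpret banach_space_over sE by fact
  obtain r :: "'k \<Rightarrow>\<^sub>L real" where r1: "r 1 = 1"
    and r: "(\<forall>z. r z *\<^sub>R 1 = z) \<or> (\<exists>i. i * i = - 1 \<and> r i = 0 \<and> (\<forall>z. r z *\<^sub>R 1 - r (i * z) *\<^sub>R i = z))"
    by (rule real_part_exists)
  have vsk: "vector_space ((*) :: 'k \<Rightarrow> 'k \<Rightarrow> 'k)" by unfold_locales (simp_all add: algebra_simps)
  have vse: "vector_space sE" by (rule vector_space_axioms)
  have sR: "sE (a *\<^sub>R 1) x = a *\<^sub>R x" for a x using scale_of_real[of a x] by (simp add: of_real_def)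
  from r show thesis
  proof (elim disjE exE conjE)
    assume z: "\<forall>z. r z *\<^sub>R 1 = z"
    have bl: "bounded_linear (\<lambda>x. \<psi> x *\<^sub>R (1::'k))" by (intro bounded_linear_intros)
    show thesis
    proof (rule that[of "Blinfun (\<lambda>x. \<psi> x *\<^sub>R (1::'k))" r])
      have "\<psi> (sE c x) *\<^sub>R 1 = c * \<psi> x *\<^sub>R 1" for c x
      proof -
        have c: "r c *\<^sub>R 1 = c" using z by blast
        have "\<psi> (sE (r c *\<^sub>R 1) x) *\<^sub>R 1 = \<psi> x *\<^sub>R (r c *\<^sub>R (1::'k))"
          unfolding sR by (simp add: blinfun.scaleR_right mult.commute)
        then have "\<psi> (sE c x) *\<^sub>R 1 = \<psi> x *\<^sub>R c" unfolding c .
        then show ?thesis by simp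
      qed
      then show "Blinfun (\<lambda>x. \<psi> x *\<^sub>R (1::'k)) \<in> dual_space sE"
        using vsk vse bl by (auto simp: dual_space_def Vector_Spaces.linear_iff bounded_linear_Blinfun_apply
            blinfun.add_right scaleR_add_left)
    qed (simp add: bl bounded_linear_Blinfun_apply blinfun.scaleR_right r1)
  next
    fix i assume i: "i * i = - 1" "r i = 0" and z: "\<forall>z. r z *\<^sub>R 1 - r (i * z) *\<^sub>R i = z"
    let ?\<Psi> = "\<lambda>x. \<psi> x *\<^sub>R 1 - \<psi> (sE i x) *\<^sub>R i"
    have sRc: "sE i (a *\<^sub>R x) = a *\<^sub>R sE i x" for a x
      using scale_left_commute[of i "of_real a" x] by (simp only: scale_of_real)
    have "bounded_linear (sE i)"
      by (rule bounded_linear_intro[of _ "norm i"]) (simp_all add: scale_right_distrib sRc norm_scale mult.commute)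
    then have bl: "bounded_linear ?\<Psi>"
      by (intro bounded_linear_intros bounded_linear_compose[OF blinfun.bounded_linear_right])
    have ii: "sE i (sE i x) = - x" for x
      using scale_scale[of i i x] i by simp
    show thesis
    proof (rule that[of "Blinfun ?\<Psi>" r])
      have "?\<Psi> (sE c x) = c * ?\<Psi> x" for c x
      proof -
        obtain a b where c: "c = a *\<^sub>R 1 + b *\<^sub>R i" 
          by (rule that[of "r c" "- r (i * c)"]) (use spec[OF z, of c] in simp)
        have "sE (b *\<^sub>R i) x = b *\<^sub>R sE i x" for x
          using sR[of b "sE i x"] scale_scale[of "b *\<^sub>R 1" i x]
          by (simp only: mult_scaleR_left mult.left_neutral)
        then have ci: "sE c x = a *\<^sub>R x + b *\<^sub>R sE i x" for x
          by (simp add: c scale_left_distrib sR)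
        have si: "sE i (sE c x) = a *\<^sub>R sE i x - b *\<^sub>R x"
          by (simp add: ci scale_right_distrib sRc ii del: scale_scale)
        have "\<psi> (sE c x) = a * \<psi> x + b * \<psi> (sE i x)"
          unfolding ci by (simp add: blinfun.add_right blinfun.scaleR_right)
        moreover have "\<psi> (sE i (sE c x)) = a * \<psi> (sE i x) - b * \<psi> x"
          unfolding si by (simp add: blinfun.diff_right blinfun.scaleR_right)
        ultimately have "?\<Psi> (sE c x) = (a * \<psi> x + b * \<psi> (sE i x)) *\<^sub>R 1 - (a * \<psi> (sE i x) - b * \<psi> x) *\<^sub>R i"
          by simp
        also have "\<dots> = c * ?\<Psi> x" unfolding c by (simp add: algebra_simps i(1))
        finally show ?thesis .
      qed
      then show "Blinfun ?\<Psi> \<in> dual_space sE"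
        using vsk vse bl by (auto simp: dual_space_def Vector_Spaces.linear_iff bounded_linear_Blinfun_apply
            scale_right_distrib blinfun.add_right scaleR_add_left)
    qed (simp add: bl bounded_linear_Blinfun_apply blinfun.scaleR_right blinfun.diff_right r1 i)
  qed
qed

lemma weak_limit_dual:
  assumes "limitin (weak_topology sE) x l sequentially" and "\<psi> \<in> dual_space sE"
  shows "(\<lambda>n. blinfun_apply \<psi> (x n)) \<longlonglongrightarrow> blinfun_apply \<psi> l"
proof (rule topological_tendstoI)
  fix U assume "open U" "\<psi> l \<in> U"
  with assms(2) have "openin (weak_topology sE) (\<psi> -` U)" "l \<in> \<psi> -` U"
    unfolding weak_topology_def by (auto intro!: topology_generated_by_Basis)
  with assms(1) have "\<forall>\<^sub>F n in sequentially. x n \<in> \<psi> -` U" unfolding limitin_def by blast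
  then show "\<forall>\<^sub>F n in sequentially. \<psi> (x n) \<in> U" by simp
qed

text \<open>\<open>\<psi>\<close> is the real part of a member of the dual, hence weakly continuous
  although it is only real-linear.\<close>

lemma weak_limit_real_functional:
  fixes \<psi> :: "'e::banach \<Rightarrow>\<^sub>L real"
  assumes sE: "banach_space_over sE" and lim: "limitin (weak_topology sE) x l sequentially"
  shows "(\<lambda>n. \<psi> (x n)) \<longlonglongrightarrow> \<psi> l"
proof -
  obtain \<Psi> r where \<Psi>: "\<Psi> \<in> dual_space sE" and r: "\<And>x. blinfun_apply r (blinfun_apply \<Psi> x) = \<psi> x"
    using real_functional_extends[OF sE, of \<psi>] by blast
  from blinfun.tendsto[OF tendsto_const weak_limit_dual[OF lim \<Psi>], of r] show ?thesis by (simp add: r)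
qed

lemma limitin_topology_generated_by:
  assumes "l \<in> \<Union>\<B>" and "\<And>U. U \<in> \<B> \<Longrightarrow> l \<in> U \<Longrightarrow> eventually (\<lambda>n. x n \<in> U) F"
  shows "limitin (topology_generated_by \<B>) x l F"
  unfolding limitin_def
proof (intro conjI allI impI)
  show "l \<in> topspace (topology_generated_by \<B>)" using assms(1) by simp
  fix U assume "openin (topology_generated_by \<B>) U \<and> l \<in> U"
  then have "generate_topology_on \<B> U" "l \<in> U" by (simp_all add: openin_topology_generated_by_iff)
  then show "eventually (\<lambda>n. x n \<in> U) F"
  proof (induction rule: generate_topology_on.induct)
    case (Int A B)
    then show ?case using eventually_conj by auto
  next
    case (UN K)
    then obtain A where "A \<in> K" "l \<in> A" by blast
    with UN have "eventually (\<lambda>n. x n \<in> A) F" by blast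
    then show ?case by eventually_elim (use \<open>A \<in> K\<close> in blast)
  qed (use assms(2) in auto)
qed

text \<open>A functional \<open>\<phi>\<close> over the scalar field is reassembled from the real
  functionals \<open>y \<mapsto> r (\<phi> y)\<close> and, in the complex case,
  \<open>y \<mapsto> r (i * \<phi> y)\<close>. This lets the measure theory stay
  real-valued.\<close>

lemma weak_limitI:
  fixes sF :: "'k::real_or_complex \<Rightarrow> 'f::banach \<Rightarrow> 'f"
  assumes sF: "banach_space_over sF" and lim: "\<And>\<phi> :: 'f \<Rightarrow>\<^sub>L real. (\<lambda>n. \<phi> (y n)) \<longlonglongrightarrow> \<phi> l"
  shows "limitin (weak_topology sF) y l sequentially"
  unfolding weak_topology_def
proof (rule limitin_topology_generated_by)
  interpret banach_space_over sF by fact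
  have "vector_space ((*) :: 'k \<Rightarrow> 'k \<Rightarrow> 'k)" by unfold_locales (simp_all add: algebra_simps)
  \<comment> \<open>The subbasis has to cover the limit point; the zero functional with
    \<open>UNIV\<close> provides a member that does.\<close>
  then have "(0 :: 'f \<Rightarrow>\<^sub>L 'k) \<in> dual_space sF"
    using vector_space_axioms by (simp add: dual_space_def Vector_Spaces.linear_iff)
  moreover have "l \<in> blinfun_apply (0 :: 'f \<Rightarrow>\<^sub>L 'k) -` UNIV" by simp
  ultimately show "l \<in> \<Union>{blinfun_apply \<phi> -` U |\<phi> U. \<phi> \<in> dual_space sF \<and> open U}"
    using open_UNIV by blast
next
  fix V assume "V \<in> {blinfun_apply \<phi> -` U |\<phi> U. \<phi> \<in> dual_space sF \<and> open U}" and l: "l \<in> V"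
  then obtain \<phi> :: "'f \<Rightarrow>\<^sub>L 'k" and U where V: "V = blinfun_apply \<phi> -` U" and U: "open U" by auto
  obtain r :: "'k \<Rightarrow>\<^sub>L real" where
    r: "(\<forall>z. r z *\<^sub>R 1 = z) \<or> (\<exists>i. i * i = - 1 \<and> r i = 0 \<and> (\<forall>z. r z *\<^sub>R 1 - r (i * z) *\<^sub>R i = z))"
    by (rule real_part_exists)
  have lim': "(\<lambda>n. u (y n)) \<longlonglongrightarrow> u l" if "bounded_linear u" for u :: "'f \<Rightarrow> real"
    using lim[of "Blinfun u"] bounded_linear_Blinfun_apply[OF that] by simp
  have "(\<lambda>n. \<phi> (y n)) \<longlonglongrightarrow> \<phi> l"
    using r
  proof (elim disjE exE conjE)
    assume z: "\<forall>z. r z *\<^sub>R 1 = z"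
    have "(\<lambda>n. r (\<phi> (y n))) \<longlonglongrightarrow> r (\<phi> l)"
      by (rule lim'[of "\<lambda>y. r (\<phi> y)"]) (intro bounded_linear_compose[OF blinfun.bounded_linear_right] blinfun.bounded_linear_right)
    then have "(\<lambda>n. r (\<phi> (y n)) *\<^sub>R 1) \<longlonglongrightarrow> r (\<phi> l) *\<^sub>R (1 :: 'k)"
      by (intro tendsto_scaleR tendsto_const)
    then show ?thesis by (simp only: z[rule_format])
  next
    fix i assume z: "\<forall>z. r z *\<^sub>R 1 - r (i * z) *\<^sub>R i = z"
    have c1: "(\<lambda>n. r (\<phi> (y n))) \<longlonglongrightarrow> r (\<phi> l)"
      by (rule lim'[of "\<lambda>y. r (\<phi> y)"]) (intro bounded_linear_compose[OF blinfun.bounded_linear_right] blinfun.bounded_linear_right)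
    have c2: "(\<lambda>n. r (i * \<phi> (y n))) \<longlonglongrightarrow> r (i * \<phi> l)"
      by (rule lim'[of "\<lambda>y. r (i * \<phi> y)"]) (intro bounded_linear_compose[OF blinfun.bounded_linear_right]
            bounded_linear_compose[OF bounded_linear_mult_right] blinfun.bounded_linear_right)
    have "(\<lambda>n. r (\<phi> (y n)) *\<^sub>R 1 - r (i * \<phi> (y n)) *\<^sub>R i) \<longlonglongrightarrow> r (\<phi> l) *\<^sub>R 1 - r (i * \<phi> l) *\<^sub>R i"
      by (rule tendsto_diff[OF tendsto_scaleR[OF c1 tendsto_const] tendsto_scaleR[OF c2 tendsto_const]])
    then show ?thesis by (simp only: z[rule_format])
  qed
  from topological_tendstoD[OF this U] l show "\<forall>\<^sub>F n in sequentially. y n \<in> V" by (simp add: V)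
qed

section \<open>Separable ranges and weak limits in \<open>M_space\<close>\<close>

text \<open>One point of \<open>A\<close> is picked in each ball of radius
  \<open>1 / (n + 1)\<close> about a point of \<open>D\<close> that meets \<open>A\<close>;
  \<open>P\<close> indexes these balls. This is the heredity of separability in metric
  spaces.\<close>

lemma countable_dense_subset_of_closure:
  fixes A D :: "'a::metric_space set"
  assumes "countable D" and "A \<subseteq> closure D"
  obtains C where "countable C" and "C \<subseteq> A" and "A \<subseteq> closure C"
proof -
  define P where "P = {(d, n::nat). d \<in> D \<and> (\<exists>a\<in>A. dist d a < inverse (Suc n))}"
  define c where "c = (\<lambda>(d, n::nat). SOME a. a \<in> A \<and> dist d a < inverse (Suc n))"
  have c: "c (d, n) \<in> A \<and> dist d (c (d, n)) < inverse (Suc n)" if "(d, n) \<in> P" for d n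
    using that unfolding c_def P_def by (auto intro: someI2_ex)
  have "countable P"
    by (rule countable_subset[of _ "D \<times> UNIV"]) (auto simp: P_def assms(1))
  moreover have "a \<in> closure (c ` P)" if a: "a \<in> A" for a
    unfolding closure_approachable
  proof (intro allI impI)
    fix e :: real assume "e > 0"
    then obtain n where n: "inverse (Suc n) < e / 2" using reals_Archimedean[of "e / 2"] by auto
    have "a \<in> closure D" using a assms(2) by blast
    moreover have "inverse (real (Suc n)) > 0" by simp
    ultimately obtain d where d: "d \<in> D" "dist d a < inverse (Suc n)"
      unfolding closure_approachable by blast
    with a have P: "(d, n) \<in> P" by (auto simp: P_def)
    have "dist (c (d, n)) a \<le> dist d (c (d, n)) + dist d a" by (rule dist_triangle3)
    also have "\<dots> < e" using c[OF P] d n by simp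
    finally show "\<exists>y\<in>c ` P. dist y a < e" using P by blast
  qed
  ultimately show thesis using c by (intro that[of "c ` P"]) auto
qed

text \<open>Letting \<open>D\<close> leave \<open>A\<close> is what allows a single \<open>D\<close>
  for the ranges of many functions.\<close>

lemma separable_space_top_of_set_iff:
  fixes A :: "'a::metric_space set"
  shows "separable_space (top_of_set A) \<longleftrightarrow> (\<exists>D. countable D \<and> A \<subseteq> closure D)"
proof
  assume "separable_space (top_of_set A)"
  then show "\<exists>D. countable D \<and> A \<subseteq> closure D"
    unfolding separable_space_def by (auto simp: closure_of_subtopology)
next
  assume "\<exists>D. countable D \<and> A \<subseteq> closure D"
  then obtain C where "countable C" "C \<subseteq> A" "A \<subseteq> closure C"
    using countable_dense_subset_of_closure by metis
  then show "separable_space (top_of_set A)"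
    unfolding separable_space_def by (intro exI[of _ C]) (auto simp: closure_of_subtopology Int_absorb1)
qed

lemma M_space_real_functional_measurable:
  fixes \<psi> :: "'e::banach \<Rightarrow>\<^sub>L real"
  assumes sE: "banach_space_over sE" and f: "f \<in> M_space sE Z MM"
  shows "(\<lambda>z. \<psi> (f z)) \<in> borel_measurable (sigma Z MM)"
proof -
  obtain \<Psi> r where \<Psi>: "\<Psi> \<in> dual_space sE" and r: "\<And>x. blinfun_apply r (blinfun_apply \<Psi> x) = \<psi> x"
    using real_functional_extends[OF sE, of \<psi>] by blast
  have "(\<lambda>z. \<Psi> (f z)) \<in> borel_measurable (sigma Z MM)" using f \<Psi> by (simp add: M_space_def)
  moreover have "blinfun_apply r \<in> borel_measurable borel"
    by (intro borel_measurable_continuous_onI continuous_intros)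
  ultimately have "(\<lambda>z. r (\<Psi> (f z))) \<in> borel_measurable (sigma Z MM)" by (rule measurable_compose)
  then show ?thesis by (simp add: r)
qed

text \<open>Mazur's theorem for subspaces: a point off the closure is separated by a functional that
  vanishes on \<open>D\<close>, hence at every \<open>x n\<close> and, by weak convergence, at
  \<open>l\<close>.\<close>

lemma weak_limit_mem_closure:
  fixes x :: "nat \<Rightarrow> 'e::banach"
  assumes sE: "banach_space_over sE" and lim: "limitin (weak_topology sE) x l sequentially"
    and D: "rational_subspace D" and x: "\<And>n. x n \<in> closure D"
  shows "l \<in> closure D"
proof (rule ccontr)
  assume "l \<notin> closure D"
  then obtain L :: "'e \<Rightarrow>\<^sub>L real" where L: "\<And>x. x \<in> D \<Longrightarrow> L x = 0" "L l \<noteq> 0"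
    using separating_functional[OF D] by metis
  have "closure D \<subseteq> L -` {0}"
    using L by (intro closure_minimal closed_vimage continuous_intros) auto
  then have "L (x n) = 0" for n using x by blast
  with weak_limit_real_functional[OF sE lim, of L] L(2) show False
    by (simp add: LIMSEQ_const_iff)
qed

lemma weak_limit_norm_le:
  fixes x :: "nat \<Rightarrow> 'e::banach"
  assumes sE: "banach_space_over sE" and lim: "limitin (weak_topology sE) x l sequentially"
    and x: "\<And>n. norm (x n) \<le> C"
  shows "norm l \<le> C"
proof -
  obtain L :: "'e \<Rightarrow>\<^sub>L real" where L: "norm L \<le> 1" "L l = norm l" by (rule norming_functional)
  have "L (x n) \<le> C" for n
  proof -
    have "L (x n) \<le> norm L * norm (x n)" using norm_blinfun[of L "x n"] by simp
    also have "\<dots> \<le> norm (x n)" using L(1) by (simp add: mult_left_le_one_le)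
    finally show ?thesis using x[of n] by linarith
  qed
  with LIMSEQ_le_const2[OF weak_limit_real_functional[OF sE lim, of L]] L(2) show ?thesis by metis
qed

text \<open>\<open>D\<close> is the rational hull of countable sets that approximate the ranges of
  all \<open>f n\<close>; by Mazur's argument its closure also contains the range of the limit,
  which settles separability. Measurability passes to the limit functional by functional.\<close>

lemma M_space_weak_limit:
  fixes f :: "nat \<Rightarrow> 'z \<Rightarrow> 'e::banach"
  assumes sE: "banach_space_over sE" and f: "\<And>n. f n \<in> M_space sE Z MM"
    and C: "\<And>n z. z \<in> Z \<Longrightarrow> norm (f n z) \<le> C"
    and lim: "\<And>z. z \<in> Z \<Longrightarrow> limitin (weak_topology sE) (\<lambda>n. f n z) (g z) sequentially"
  obtains D where "countable D" and "rational_subspace D" and "\<And>n. f n ` Z \<subseteq> closure D"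
    and "g ` Z \<subseteq> closure D" and "g \<in> M_space sE Z MM"
proof -
  have "\<forall>n. \<exists>B. countable B \<and> f n ` Z \<subseteq> closure B"
    using f by (simp add: M_space_def separable_space_top_of_set_iff)
  then obtain B where B: "\<And>n. countable (B n)" "\<And>n. f n ` Z \<subseteq> closure (B n)" by metis
  have "countable (\<Union>n. B n)" using B(1) by simp
  then obtain D where D: "countable D" "rational_subspace D" "(\<Union>n. B n) \<subseteq> D"
    by (rule countable_rational_subspace)
  have fD: "f n ` Z \<subseteq> closure D" for n
    using B(2)[of n] closure_mono[of "B n" D] D(3) by blast
  then have gD: "g ` Z \<subseteq> closure D"
    using weak_limit_mem_closure[OF sE lim D(2)] by blast
  have "bounded (g ` Z)"
    using weak_limit_norm_le[OF sE lim C] by (auto intro!: boundedI)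
  moreover have "(\<lambda>z. \<psi> (g z)) \<in> borel_measurable (sigma Z MM)" if "\<psi> \<in> dual_space sE" for \<psi>
  proof (rule borel_measurable_LIMSEQ_metric)
    show "(\<lambda>z. \<psi> (f n z)) \<in> borel_measurable (sigma Z MM)" for n
      using f that by (simp add: M_space_def)
    fix z assume "z \<in> space (sigma Z MM)"
    then have z: "z \<in> Z" by (simp add: space_measure_of_conv)
    show "(\<lambda>n. \<psi> (f n z)) \<longlonglongrightarrow> \<psi> (g z)" by (rule weak_limit_dual[OF lim[OF z] that])
  qed
  ultimately have "g \<in> M_space sE Z MM"
    using D(1) gD by (auto simp: M_space_def bounded_functions_def separable_space_top_of_set_iff)
  with D fD gD show thesis by (intro that[of D]) auto
qed

section \<open>Independent convergence and finiteness of the semivariation\<close>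

text \<open>The negated Cauchy criterion for the net of finite sums: two finite sets containing
  \<open>{..<m}\<close> differ only in indices from \<open>m\<close> on, so if all such blocks were
  eventually small, the net would converge by completeness.\<close>

lemma not_summable_on_blocks:
  fixes a :: "nat \<Rightarrow> 'f::banach"
  assumes "\<not> a summable_on UNIV"
  obtains e where "e > 0" and "\<And>m. \<exists>G. finite G \<and> G \<subseteq> {m..} \<and> norm (sum a G) \<ge> e"
proof (rule ccontr)
  assume "\<not> thesis"
  with that have *: "\<exists>m. \<forall>G. finite G \<and> G \<subseteq> {m..} \<longrightarrow> norm (sum a G) < e" if "e > 0" for e
    using \<open>e > 0\<close> by (meson not_le)
  have "cauchy_filter (filtermap (sum a) (finite_subsets_at_top UNIV))"
    unfolding cauchy_filter_metric_filtermap
  proof (intro allI impI)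
    fix e :: real assume "e > 0"
    then obtain m where m: "\<And>G. finite G \<Longrightarrow> G \<subseteq> {m..} \<Longrightarrow> norm (sum a G) < e / 2"
      using *[of "e / 2"] by auto
    show "\<exists>P. eventually P (finite_subsets_at_top UNIV) \<and> (\<forall>x y. P x \<and> P y \<longrightarrow> dist (sum a x) (sum a y) < e)"
    proof (intro exI[of _ "\<lambda>X. finite X \<and> {..<m} \<subseteq> X"] conjI allI impI)
      show "\<forall>\<^sub>F X in finite_subsets_at_top UNIV. finite X \<and> {..<m} \<subseteq> X"
        unfolding eventually_finite_subsets_at_top by (intro exI[of _ "{..<m}"]) auto
      fix x y assume xy: "(finite x \<and> {..<m} \<subseteq> x) \<and> finite y \<and> {..<m} \<subseteq> y"
      have "sum a x - sum a y = sum a (x - {..<m}) - sum a (y - {..<m})"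
        using xy by (simp add: sum_diff)
      also have "norm \<dots> \<le> norm (sum a (x - {..<m})) + norm (sum a (y - {..<m}))"
        by (rule norm_triangle_ineq4)
      also have "\<dots> < e" using m[of "x - {..<m}"] m[of "y - {..<m}"] xy by fastforce
      finally show "dist (sum a x) (sum a y) < e" by (simp add: dist_norm)
    qed
  qed
  then obtain s where "(sum a \<longlongrightarrow> s) (finite_subsets_at_top UNIV)"
    using complete_UNIV[where 'a='f] finite_subsets_at_top_neq_bot
    unfolding complete_uniform filterlim_def by (metis filtermap_bot_iff principal_UNIV top_greatest UNIV_I)
  with assms show False by (auto simp: summable_on_def has_sum_def)
qed

text \<open>The Orlicz argument: blocks of norm at least \<open>e\<close> are placed in consecutive
  disjoint windows, and the subseries along their union \<open>J\<close> violates the Cauchy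
  criterion.\<close>

lemma summable_on_if_subseries_summable:
  fixes a :: "nat \<Rightarrow> 'f::banach"
  assumes "\<And>J. summable (\<lambda>n. if n \<in> J then a n else 0)"
  shows "a summable_on UNIV"
proof (rule ccontr)
  assume "\<not> a summable_on UNIV"
  then obtain e where e: "e > 0" "\<And>m. \<exists>G. finite G \<and> G \<subseteq> {m..} \<and> norm (sum a G) \<ge> e"
    using not_summable_on_blocks by blast
  then obtain G where G: "\<And>m. finite (G m)" "\<And>m. G m \<subseteq> {m..}" "\<And>m. norm (sum a (G m)) \<ge> e"
    by metis
  \<comment> \<open>The next window starts past both \<open>m\<close> and the whole block
    \<open>G m\<close>, so windows advance strictly and contain their blocks.\<close>
  define next_start where "next_start m = Suc (Max (insert m (G m)))" for m
  have gt: "m < next_start m" and Gm: "G m \<subseteq> {m..<next_start m}" for m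
    using G(1,2)[of m] by (auto simp: next_start_def less_Suc_eq_le)
  define m where "m k = (next_start ^^ k) 0" for k
  have mS: "m (Suc k) = next_start (m k)" for k by (simp add: m_def)
  have sm: "strict_mono m" unfolding strict_mono_Suc_iff using gt mS by simp
  define J where "J = (\<Union>k. G (m k))"
  \<comment> \<open>\<open>J\<close> must select no further index from a window, since other terms
    could cancel the block.\<close>
  have JG: "{m k..<m (Suc k)} \<inter> J = G (m k)" for k
  proof
    show "G (m k) \<subseteq> {m k..<m (Suc k)} \<inter> J" using Gm[of "m k"] by (auto simp: J_def mS)
    show "{m k..<m (Suc k)} \<inter> J \<subseteq> G (m k)"
    proof
      fix x assume x: "x \<in> {m k..<m (Suc k)} \<inter> J"
      then obtain l where l: "x \<in> G (m l)" by (auto simp: J_def)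
      then have xl: "m l \<le> x" "x < m (Suc l)" using Gm[of "m l"] by (auto simp: mS)
      have "l = k"
      proof (rule ccontr)
        assume "l \<noteq> k"
        then consider "Suc l \<le> k" | "Suc k \<le> l" by linarith
        then show False
          using x xl monoD[OF strict_mono_mono[OF sm], of "Suc l" k] monoD[OF strict_mono_mono[OF sm], of "Suc k" l]
          by cases auto
      qed
      with l show "x \<in> G (m k)" by simp
    qed
  qed
  obtain N where N: "\<And>i n. i \<ge> N \<Longrightarrow> norm (sum (\<lambda>n. if n \<in> J then a n else 0) {i..<n}) < e"
    using assms[of J] e(1) unfolding summable_Cauchy by blast
  have "sum (\<lambda>n. if n \<in> J then a n else 0) {m N..<m (Suc N)} = sum a (G (m N))"
    by (subst sum.inter_restrict[symmetric]) (simp_all add: JG)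
  with N[of "m N" "m (Suc N)"] strict_mono_imp_increasing[OF sm, of N] G(3)[of "m N"] show False by simp
qed

lemma disjoint_family_from_nat_into:
  assumes "countable J" and "disjoint_family_on A J"
  shows "disjoint_family (\<lambda>n. if n \<in> to_nat_on J ` J then A (from_nat_into J n) else {})"
  unfolding disjoint_family_on_def
proof (intro ballI impI)
  fix m n :: nat assume mn: "m \<noteq> n"
  let ?B = "\<lambda>n. if n \<in> to_nat_on J ` J then A (from_nat_into J n) else {}"
  show "?B m \<inter> ?B n = {}"
  proof (cases "m \<in> to_nat_on J ` J \<and> n \<in> to_nat_on J ` J")
    case True
    then obtain i j where "i \<in> J" "j \<in> J" "m = to_nat_on J i" "n = to_nat_on J j" by blast
    moreover from this mn have "i \<noteq> j" by blast
    ultimately show ?thesis using assms by (auto simp: disjoint_family_on_def)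
  qed auto
qed

text \<open>Operators are taken as real-linear here, so that the composition of \<open>\<mu>\<close>
  with a real functional on the target space is an instance too.\<close>

locale ind_measure = sigma_algebra Z MM for Z :: "'z set" and MM +
  fixes \<mu> :: "'z set \<Rightarrow> 'e::banach \<Rightarrow>\<^sub>L 'f::banach"
  assumes sums: "range A \<subseteq> MM \<Longrightarrow> disjoint_family A \<Longrightarrow> (\<lambda>n. \<mu> (A n) x) sums \<mu> (\<Union>n. A n) x"
    and indep: "range A \<subseteq> MM \<Longrightarrow> disjoint_family A \<Longrightarrow> independently_convergent (\<lambda>n. \<mu> (A n))"
begin

lemma empty [simp]: "\<mu> {} = 0"
proof (rule blinfun_eqI)
  fix x
  have "(\<lambda>n::nat. \<mu> {} x) sums \<mu> {} x" using sums[of "\<lambda>_. {}" x] by (simp add: disjoint_family_on_def)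
  then have "(\<lambda>n::nat. \<mu> {} x) \<longlonglongrightarrow> 0" by (intro summable_LIMSEQ_zero sums_summable)
  then show "\<mu> {} x = blinfun_apply 0 x" by (simp add: LIMSEQ_const_iff)
qed

text \<open>Replacing \<open>x n\<close> by 0 off \<open>J\<close> keeps the sequence bounded, so
  independent convergence gives convergence of every subseries, and hence unconditional
  convergence.\<close>

lemma summable_on_nat:
  fixes A :: "nat \<Rightarrow> 'z set"
  assumes A: "range A \<subseteq> MM" "disjoint_family A" and x: "bounded (range x)"
  shows "(\<lambda>n. \<mu> (A n) (x n)) summable_on UNIV"
proof (rule summable_on_if_subseries_summable)
  fix J :: "nat set"
  obtain C where C: "\<And>n. norm (x n) \<le> C" using x by (auto simp: bounded_iff)
  have C0: "0 \<le> C" using norm_ge_zero[of "x 0"] C[of 0] by linarith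
  have "bounded (range (\<lambda>n. if n \<in> J then x n else 0))"
    using C C0 by (intro boundedI[of _ C]) auto
  with indep[OF A] have "summable (\<lambda>n. \<mu> (A n) (if n \<in> J then x n else 0))"
    unfolding independently_convergent_def by blast
  moreover have "\<mu> (A n) (if n \<in> J then x n else 0) = (if n \<in> J then \<mu> (A n) (x n) else 0)" for n by simp
  ultimately show "summable (\<lambda>n. if n \<in> J then \<mu> (A n) (x n) else 0)" by simp
qed

lemma summable_on_countable:
  assumes J: "countable J" and A: "\<And>j. j \<in> J \<Longrightarrow> A j \<in> MM" "disjoint_family_on A J" and x: "bounded (x ` J)"
  shows "(\<lambda>j. \<mu> (A j) (x j)) summable_on J"
proof -
  let ?t = "to_nat_on J" and ?f = "from_nat_into J"
  define A' where "A' n = (if n \<in> ?t ` J then A (?f n) else {})" for n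
  define x' where "x' n = (if n \<in> ?t ` J then x (?f n) else 0)" for n
  have "(\<lambda>n. \<mu> (A' n) (x' n)) summable_on UNIV"
  proof (rule summable_on_nat)
    show "range A' \<subseteq> MM" using A J by (auto simp: A'_def)
    show "disjoint_family A'"
      unfolding A'_def using J A(2) by (rule disjoint_family_from_nat_into)
    have "range x' \<subseteq> insert 0 (x ` J)" using J by (auto simp: x'_def)
    then show "bounded (range x')" by (rule bounded_subset[rotated]) (use x in simp)
  qed
  then have "(\<lambda>n. \<mu> (A' n) (x' n)) summable_on ?t ` J" by (rule summable_on_subset_banach) simp
  then have "((\<lambda>n. \<mu> (A' n) (x' n)) \<circ> ?t) summable_on J"
    using J by (subst (asm) summable_on_reindex) auto
  then show ?thesis
    by (rule summable_on_cong[THEN iffD1, rotated]) (use J in \<open>auto simp: A'_def x'_def\<close>)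
qed

lemma has_sum_countable:
  assumes J: "countable J" and A: "\<And>j. j \<in> J \<Longrightarrow> A j \<in> MM" "disjoint_family_on A J"
  shows "((\<lambda>j. \<mu> (A j) x) has_sum \<mu> (\<Union>j\<in>J. A j) x) J"
proof -
  let ?t = "to_nat_on J" and ?f = "from_nat_into J"
  define A' where "A' n = (if n \<in> ?t ` J then A (?f n) else {})" for n
  have A': "range A' \<subseteq> MM" using A J by (auto simp: A'_def)
  have dis: "disjoint_family A'"
    unfolding A'_def using J A(2) by (rule disjoint_family_from_nat_into)
  have "(\<lambda>n. \<mu> (A' n) x) summable_on UNIV" using A' dis by (rule summable_on_nat) simp
  then obtain s where s: "((\<lambda>n. \<mu> (A' n) x) has_sum s) UNIV" by (auto simp: summable_on_def)
  have "(\<Union>n. A' n) = (\<Union>j\<in>J. A j)" using J by (auto simp: A'_def split: if_splits)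
  with sums[OF A' dis, of x] have "(\<lambda>n. \<mu> (A' n) x) sums \<mu> (\<Union>j\<in>J. A j) x" by simp
  with has_sum_imp_sums[OF s] have "s = \<mu> (\<Union>j\<in>J. A j) x" by (rule sums_unique2)
  with s have "((\<lambda>n. \<mu> (A' n) x) has_sum \<mu> (\<Union>j\<in>J. A j) x) (?t ` J)"
    by (subst has_sum_cong_neutral[of UNIV "?t ` J" _ "\<lambda>n. \<mu> (A' n) x"]) (auto simp: A'_def)
  then have "((\<lambda>n. \<mu> (A' n) x) \<circ> ?t has_sum \<mu> (\<Union>j\<in>J. A j) x) J"
    using J by (subst (asm) has_sum_reindex) auto
  then show ?thesis
    by (rule has_sum_cong[THEN iffD1, rotated]) (use J in \<open>auto simp: A'_def\<close>)
qed

lemma additive2: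
  assumes "A \<in> MM" "B \<in> MM" "A \<inter> B = {}"
  shows "\<mu> (A \<union> B) x = \<mu> A x + \<mu> B x"
proof -
  have "(\<lambda>n. \<mu> (binaryset A B n) x) sums \<mu> (\<Union>n. binaryset A B n) x"
    using assms by (intro sums) (auto simp: range_binaryset_eq disjoint_family_on_def binaryset_def)
  moreover have "(\<lambda>n. \<mu> (binaryset A B n) x) sums (\<mu> A x + \<mu> B x)" by (rule binaryset_sums) simp
  ultimately show ?thesis using sums_unique2 by (metis UN_binaryset_eq)
qed

section \<open>The semivariation: subadditivity and finiteness\<close>

definition admissible :: "'z set \<Rightarrow> (nat \<times> (nat \<Rightarrow> 'z set) \<times> (nat \<Rightarrow> 'e)) set" where
  "admissible B = {(N, A, x). (\<forall>k<N. A k \<in> MM \<and> A k \<subseteq> B \<and> norm (x k) \<le> 1) \<and> disjoint_family_on A {..<N}}"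

text \<open>The total semivariation is \<open>semivar Z\<close>. Values in \<open>ennreal\<close>
  allow computing with it before finiteness is known.\<close>

definition semivar :: "'z set \<Rightarrow> ennreal" where
  "semivar B = (SUP (N, A, x)\<in>admissible B. ennreal (norm (\<Sum>k<N. \<mu> (A k) (x k))))"

text \<open>A bijection with \<open>{..<card J}\<close> reduces arbitrary finite index sets to the
  initial segments of \<open>admissible\<close>; index sets of pairs and disjoint sums occur
  later.\<close>

lemma le_semivar:
  assumes J: "finite J" and A: "\<And>j. j \<in> J \<Longrightarrow> A j \<in> MM" "\<And>j. j \<in> J \<Longrightarrow> A j \<subseteq> B"
    and dis: "disjoint_family_on A J" and x: "\<And>j. j \<in> J \<Longrightarrow> norm (x j) \<le> 1"
  shows "ennreal (norm (\<Sum>j\<in>J. \<mu> (A j) (x j))) \<le> semivar B"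
proof -
  obtain h where h: "bij_betw h {..<card J} J"
    using J by (metis bij_betw_from_nat_into_finite)
  then have hJ: "k < card J \<Longrightarrow> h k \<in> J" for k by (auto dest: bij_betwE)
  have "disjoint_family_on (A \<circ> h) {..<card J}"
    unfolding disjoint_family_on_def
  proof (intro ballI impI)
    fix k l assume "k \<in> {..<card J}" "l \<in> {..<card J}" "k \<noteq> l"
    then have "h k \<noteq> h l" "h k \<in> J" "h l \<in> J" using h hJ by (auto simp: bij_betw_def inj_on_def)
    with dis show "(A \<circ> h) k \<inter> (A \<circ> h) l = {}" by (auto simp: disjoint_family_on_def)
  qed
  then have "(card J, A \<circ> h, x \<circ> h) \<in> admissible B"
    using A x hJ by (auto simp: admissible_def)
  then have "ennreal (norm (\<Sum>k<card J. \<mu> ((A \<circ> h) k) ((x \<circ> h) k))) \<le> semivar B"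
    unfolding semivar_def by (rule SUP_upper2) simp
  also have "(\<Sum>k<card J. \<mu> ((A \<circ> h) k) ((x \<circ> h) k)) = (\<Sum>j\<in>J. \<mu> (A j) (x j))"
    using sum.reindex_bij_betw[OF h, of "\<lambda>j. \<mu> (A j) (x j)"] by simp
  finally show ?thesis .
qed

lemma semivar_le:
  assumes "\<And>(N::nat) A x. (\<And>k. k < N \<Longrightarrow> A k \<in> MM) \<Longrightarrow> (\<And>k. k < N \<Longrightarrow> A k \<subseteq> B) \<Longrightarrow>
    disjoint_family_on A {..<N} \<Longrightarrow> (\<And>k. k < N \<Longrightarrow> norm (x k) \<le> 1) \<Longrightarrow>
    ennreal (norm (\<Sum>k<N. \<mu> (A k) (x k))) \<le> c"
  shows "semivar B \<le> c"
  unfolding semivar_def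
proof (rule SUP_least, clarify)
  fix N A x assume "(N, A, x) \<in> admissible B"
  then show "ennreal (norm (\<Sum>k<N. \<mu> (A k) (x k))) \<le> c"
    by (intro assms) (auto simp: admissible_def)
qed

lemma less_semivarE:
  assumes "c < semivar B"
  obtains N A x where "(N, A, x) \<in> admissible B" and "c < ennreal (norm (\<Sum>k<N. \<mu> (A k) (x k)))"
  using assms unfolding semivar_def less_SUP_iff by auto

lemma admissibleD:
  assumes "(N, A, x) \<in> admissible B"
  shows "k < N \<Longrightarrow> A k \<in> MM" and "k < N \<Longrightarrow> A k \<subseteq> B" and "k < N \<Longrightarrow> norm (x k) \<le> 1"
    and "disjoint_family_on A {..<N}"
  using assms by (auto simp: admissible_def)

lemma norm_le_semivar:
  assumes "A \<in> MM" "A \<subseteq> B" "norm x \<le> 1"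
  shows "ennreal (norm (\<mu> A x)) \<le> semivar B"
  using le_semivar[of "{()}" "\<lambda>_. A" B "\<lambda>_. x"] assms by (simp add: disjoint_family_on_def)

lemma semivar_mono: "B \<subseteq> C \<Longrightarrow> semivar B \<le> semivar C"
  by (rule semivar_le) (auto intro!: le_semivar)

lemma semivar_empty [simp]: "semivar {} = 0"
proof -
  have "semivar {} \<le> 0"
  proof (rule semivar_le)
    fix N :: nat and A and x :: "nat \<Rightarrow> 'e" assume "\<And>k. k < N \<Longrightarrow> A k \<subseteq> ({} :: 'z set)"
    then have "(\<Sum>k<N. \<mu> (A k) (x k)) = 0" by (intro sum.neutral) auto
    then show "ennreal (norm (\<Sum>k<N. \<mu> (A k) (x k))) \<le> 0" by simp
  qed
  then show ?thesis by simp
qed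

text \<open>Each \<open>A k\<close> is cut into the pieces \<open>A k \<inter> B i\<close>. For
  fixed \<open>i\<close> the sum over \<open>k\<close> is bounded by \<open>semivar (B i)\<close>,
  and countable additivity recovers the original sum as a limit over \<open>i\<close>.\<close>

lemma semivar_countably_subadditive:
  fixes B :: "nat \<Rightarrow> 'z set"
  assumes B: "range B \<subseteq> MM" "disjoint_family B"
  shows "semivar (\<Union>i. B i) \<le> (\<Sum>i. semivar (B i))"
proof (rule semivar_le)
  have B': "B i \<in> MM" for i using B(1) by blast
  fix N A and x :: "nat \<Rightarrow> 'e"
  assume A: "\<And>k. k < N \<Longrightarrow> A k \<in> MM" "\<And>k. k < N \<Longrightarrow> A k \<subseteq> (\<Union>i. B i)"
    and dis: "disjoint_family_on A {..<N}" and x: "\<And>k. k < N \<Longrightarrow> norm (x k) \<le> 1"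
  let ?S = "\<lambda>i. \<Sum>k<N. \<mu> (A k \<inter> B i) (x k)"
  have "(\<lambda>i. \<mu> (A k \<inter> B i) (x k)) sums \<mu> (A k) (x k)" if k: "k < N" for k
  proof -
    have "(\<Union>i. A k \<inter> B i) = A k" using A(2)[OF k] by blast
    moreover have "disjoint_family (\<lambda>i. A k \<inter> B i)" using B(2) by (auto simp: disjoint_family_on_def)
    moreover have "range (\<lambda>i. A k \<inter> B i) \<subseteq> MM" using A(1)[OF k] B(1) by auto
    ultimately show ?thesis using sums[of "\<lambda>i. A k \<inter> B i" "x k"] by simp
  qed
  then have "?S sums (\<Sum>k<N. \<mu> (A k) (x k))" by (intro sums_sum) auto
  then have lim: "(\<lambda>n. ennreal (norm (\<Sum>i<n. ?S i))) \<longlonglongrightarrow> ennreal (norm (\<Sum>k<N. \<mu> (A k) (x k)))"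
    unfolding sums_def by (intro tendsto_ennrealI tendsto_norm)
  have "ennreal (norm (\<Sum>i<n. ?S i)) \<le> (\<Sum>i. semivar (B i))" for n
  proof -
    have "ennreal (norm (\<Sum>i<n. ?S i)) \<le> ennreal (\<Sum>i<n. norm (?S i))"
      by (intro ennreal_leI norm_sum)
    also have "\<dots> = (\<Sum>i<n. ennreal (norm (?S i)))" by (simp add: sum_ennreal)
    also have "\<dots> \<le> (\<Sum>i<n. semivar (B i))"
    proof (intro sum_mono le_semivar)
      show "disjoint_family_on (\<lambda>k. A k \<inter> B i) {..<N}" for i
        using dis by (auto simp: disjoint_family_on_def)
    qed (use A B' x in auto)
    also have "\<dots> \<le> (\<Sum>i. semivar (B i))" by (rule sum_le_suminf) auto
    finally show ?thesis .
  qed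
  then show "ennreal (norm (\<Sum>k<N. \<mu> (A k) (x k))) \<le> (\<Sum>i. semivar (B i))"
    by (intro LIMSEQ_le_const2[OF lim]) auto
qed

lemma semivar_subadditive:
  assumes "A \<in> MM" "B \<in> MM" "A \<inter> B = {}"
  shows "semivar (A \<union> B) \<le> semivar A + semivar B"
proof -
  have "semivar (\<Union>i. binaryset A B i) \<le> (\<Sum>i. semivar (binaryset A B i))"
    using assms by (intro semivar_countably_subadditive)
      (auto simp: range_binaryset_eq disjoint_family_on_def binaryset_def)
  then show ?thesis by (simp add: UN_binaryset_eq suminf_binaryset_eq)
qed

text \<open>The splitting step in Rudin's proof that complex measures have finite variation.\<close>

lemma semivar_top_split:
  assumes B: "B \<in> MM" and top: "semivar B = top"
  obtains C where "C \<in> MM" and "C \<subseteq> B" and "semivar C = top" and "semivar (B - C) > 1"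
proof -
  \<comment> \<open>The constant 3 leaves room for two errors of at most 1 each in the final
    estimate.\<close>
  have "ennreal (norm (\<mu> B) + 3) < semivar B" by (simp add: top)
  then obtain N A x where adm: "(N, A, x) \<in> admissible B"
    and gt: "ennreal (norm (\<mu> B) + 3) < ennreal (norm (\<Sum>k<N. \<mu> (A k) (x k)))"
    by (rule less_semivarE)
  note A = admissibleD(1,2)[OF adm] and x = admissibleD(3)[OF adm] and dis = admissibleD(4)[OF adm]
  from gt have gt: "norm (\<mu> B) + 3 < norm (\<Sum>k<N. \<mu> (A k) (x k))"
    by (subst (asm) ennreal_less_iff) auto
  define U where "U = (\<Union>k<N. A k)"
  have U: "U \<in> MM" "U \<subseteq> B" using A by (auto simp: U_def)
  show thesis
  \<comment> \<open>If \<open>B - U\<close> has infinite semivariation it serves as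
    \<open>C\<close>, and \<open>U\<close> already carries a sum larger than 1. Otherwise
    \<open>U\<close> has infinite semivariation, and by finite subadditivity so has one of the
    \<open>A k\<close>.\<close>
  proof (cases "semivar (B - U) = top")
    case True
    have "ennreal 1 < ennreal (norm (\<Sum>k<N. \<mu> (A k) (x k)))"
      using gt by (subst ennreal_less_iff) (auto intro: order.strict_trans1[of _ "norm (\<mu> B) + 3"])
    also have "\<dots> \<le> semivar U" using A dis x by (intro le_semivar) (auto simp: U_def)
    finally have "semivar (B - (B - U)) > 1" using U by (simp add: double_diff)
    with True U B show thesis by (intro that[of "B - U"]) auto
  next
    case False
    have "semivar (\<Union>k<n. A k) \<le> (\<Sum>k<n. semivar (A k))" if "n \<le> N" for n
      using that
    proof (induction n)
      case (Suc n)
      have "A n \<inter> A k = {}" if "k < n" for k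
        using dis Suc.prems that by (auto simp: disjoint_family_on_def)
      then have "semivar (A n \<union> (\<Union>k<n. A k)) \<le> semivar (A n) + semivar (\<Union>k<n. A k)"
        using A Suc.prems by (intro semivar_subadditive) auto
      also have "\<dots> \<le> semivar (A n) + (\<Sum>k<n. semivar (A k))" using Suc by (intro add_left_mono) simp
      finally show ?case by (simp add: lessThan_Suc add.commute)
    qed simp
    then have "semivar U \<le> (\<Sum>k<N. semivar (A k))" unfolding U_def by simp
    moreover have "semivar U = top"
      using semivar_subadditive[of U "B - U"] U Diff[OF B U(1)] False top by (simp add: Un_absorb1 top_unique)
    ultimately have "(\<Sum>k<N. semivar (A k)) = top" by (simp add: top_unique)
    then obtain k where k: "k < N" "semivar (A k) = top" by (auto simp: ennreal_sum_eq_top)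
    \<comment> \<open>Otherwise \<open>\<mu> (A k) (x k)\<close> is within 1 of
      \<open>\<mu> B (x k)\<close>, and the other terms, which live in \<open>B - A k\<close>, add
      at most 1: too little for the chosen sum.\<close>
    have "semivar (B - A k) > 1"
    proof (rule ccontr)
      assume "\<not> semivar (B - A k) > 1"
      then have le: "semivar (B - A k) \<le> ennreal 1" by simp
      have "A j \<inter> A k = {}" if "j < N" "j \<noteq> k" for j
        using dis k that by (auto simp: disjoint_family_on_def)
      moreover have "disjoint_family_on A ({..<N} - {k})"
        using dis by (rule disjoint_family_on_mono[rotated]) auto
      ultimately have "ennreal (norm (\<Sum>j\<in>{..<N} - {k}. \<mu> (A j) (x j))) \<le> semivar (B - A k)"
        using A x k by (intro le_semivar) blast+
      with le have "ennreal (norm (\<Sum>j\<in>{..<N} - {k}. \<mu> (A j) (x j))) \<le> ennreal 1" by (rule order_trans[rotated])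
      then have 1: "norm (\<Sum>j\<in>{..<N} - {k}. \<mu> (A j) (x j)) \<le> 1"
        by (subst (asm) ennreal_le_iff) auto
      have "(\<Sum>j<N. \<mu> (A j) (x j)) = \<mu> (A k) (x k) + (\<Sum>j\<in>{..<N} - {k}. \<mu> (A j) (x j))"
        using k by (intro sum.remove) auto
      then have 2: "norm (\<Sum>j<N. \<mu> (A j) (x j)) \<le> norm (\<mu> (A k) (x k)) + norm (\<Sum>j\<in>{..<N} - {k}. \<mu> (A j) (x j))"
        by (simp add: norm_triangle_ineq)
      have "ennreal (norm (\<mu> (B - A k) (x k))) \<le> semivar (B - A k)"
        using A B k x by (intro norm_le_semivar) auto
      with le have "ennreal (norm (\<mu> (B - A k) (x k))) \<le> ennreal 1" by (rule order_trans[rotated])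
      then have 3: "norm (\<mu> (B - A k) (x k)) \<le> 1" by (subst (asm) ennreal_le_iff) auto
      have "\<mu> B (x k) = \<mu> (A k) (x k) + \<mu> (B - A k) (x k)"
        using additive2[of "A k" "B - A k" "x k"] A B k Diff[OF B A(1)[OF k(1)]] by (simp add: Un_absorb1)
      then have "\<mu> (A k) (x k) = \<mu> B (x k) - \<mu> (B - A k) (x k)" by simp
      then have 4: "norm (\<mu> (A k) (x k)) \<le> norm (\<mu> B (x k)) + norm (\<mu> (B - A k) (x k))"
        by (simp add: norm_triangle_ineq4)
      have "norm (\<mu> B (x k)) \<le> norm (\<mu> B) * norm (x k)" by (rule norm_blinfun)
      also have "\<dots> \<le> norm (\<mu> B)" using x[OF k(1)] by (simp add: mult_left_le)
      finally show False using 1 2 3 4 gt by linarith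
    qed
    with A k show thesis by (intro that[of "A k"]) auto
  qed
qed

text \<open>Admissible systems with sums above 1 from all the \<open>D k\<close> combine into one
  countable disjoint family with vectors in the unit ball. Its unconditional summability would make
  all but finitely many of these blocks small.\<close>

lemma not_infinitely_many_large:
  fixes D :: "nat \<Rightarrow> 'z set"
  assumes dis: "disjoint_family D" and large: "\<And>k. semivar (D k) > 1"
  shows False
proof -
  let ?Q = "\<lambda>k p. p \<in> admissible (D k) \<and>
    1 < ennreal (norm (\<Sum>j<fst p. \<mu> (fst (snd p) j) (snd (snd p) j)))"
  have "\<exists>p. ?Q k p" for k
  proof -
    obtain N A x where "(N, A, x) \<in> admissible (D k)" "1 < ennreal (norm (\<Sum>j<N. \<mu> (A j) (x j)))"
      by (rule less_semivarE[OF large[of k]])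
    then have "?Q k (N, A, x)" by simp
    then show ?thesis by (rule exI)
  qed
  then obtain P where P: "\<And>k. ?Q k (P k)" using choice[of ?Q] by blast
  define N A x where "N k = fst (P k)" and "A k = fst (snd (P k))" and "x k = snd (snd (P k))" for k
  have adm: "(N k, A k, x k) \<in> admissible (D k)" for k using P[of k] by (simp add: N_def A_def x_def)
  have gt: "1 < ennreal (norm (\<Sum>j<N k. \<mu> (A k j) (x k j)))" for k
    using P[of k] by (simp add: N_def A_def x_def)
  note A = admissibleD(1,2)[OF adm] and x = admissibleD(3)[OF adm] and disA = admissibleD(4)[OF adm]
  let ?J = "SIGMA k:(UNIV::nat set). {..<N k}"
  let ?a = "\<lambda>(k, j). \<mu> (A k j) (x k j)"
  have "(\<lambda>i. \<mu> (case i of (k, j) \<Rightarrow> A k j) (case i of (k, j) \<Rightarrow> x k j)) summable_on ?J"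
  proof (rule summable_on_countable)
    show "disjoint_family_on (\<lambda>i. case i of (k, j) \<Rightarrow> A k j) ?J"
      unfolding disjoint_family_on_def
    proof (intro ballI impI)
      fix p q assume pq: "p \<in> ?J" "q \<in> ?J" "p \<noteq> q"
      obtain k j l i where e: "p = (k, j)" "q = (l, i)" by (metis prod.exhaust)
      show "(case p of (k, j) \<Rightarrow> A k j) \<inter> (case q of (k, j) \<Rightarrow> A k j) = {}"
      proof (cases "k = l")
        case True
        with pq e disA[of k] show ?thesis by (auto simp: disjoint_family_on_def)
      next
        case False
        with dis have "D k \<inter> D l = {}" by (auto simp: disjoint_family_on_def)
        with pq e A(2) show ?thesis by fastforce
      qed
    qed
    show "bounded ((\<lambda>i. case i of (k, j) \<Rightarrow> x k j) ` ?J)"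
      using x by (intro boundedI[of _ 1]) auto
  qed (use A in auto)
  then have "?a summable_on ?J" by (simp add: case_prod_unfold)
  then obtain s where "(?a has_sum s) ?J" by (auto simp: summable_on_def)
  then have "(sum ?a \<longlongrightarrow> s) (finite_subsets_at_top ?J)" by (simp add: has_sum_def)
  from tendstoD[OF this, of "1/2"] obtain F where F: "finite F" "F \<subseteq> ?J"
    "\<And>Y. finite Y \<Longrightarrow> F \<subseteq> Y \<Longrightarrow> Y \<subseteq> ?J \<Longrightarrow> dist (sum ?a Y) s < 1/2"
    unfolding eventually_finite_subsets_at_top by force
  \<comment> \<open>A finite \<open>F\<close> meets only finitely many blocks; adding a whole block
    outside it keeps the sum within 1/2 of \<open>s\<close>, so the block itself has norm below
    1.\<close>
  obtain k where k: "k \<notin> fst ` F" using F(1) ex_new_if_finite[of "fst ` F"] infinite_UNIV_nat by blast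
  let ?G = "Pair k ` {..<N k}"
  have "sum ?a (F \<union> ?G) = sum ?a F + sum ?a ?G"
    using F(1) k by (intro sum.union_disjoint) force+
  also have "sum ?a ?G = (\<Sum>j<N k. \<mu> (A k j) (x k j))"
    by (subst sum.reindex) (auto simp: inj_on_def)
  finally have "norm (\<Sum>j<N k. \<mu> (A k j) (x k j)) = dist (sum ?a (F \<union> ?G)) (sum ?a F)"
    by (simp add: dist_norm)
  also have "\<dots> \<le> dist (sum ?a (F \<union> ?G)) s + dist (sum ?a F) s" by (rule dist_triangle2)
  also have "\<dots> < 1/2 + 1/2" using F by (intro add_strict_mono F(3)) auto
  finally have "ennreal (norm (\<Sum>j<N k. \<mu> (A k j) (x k j))) \<le> ennreal 1" by (intro ennreal_leI) simp
  with gt[of k] show False by simp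
qed

text \<open>Iterated splitting yields a decreasing sequence of sets of infinite semivariation whose
  disjoint differences each have semivariation above 1.\<close>

lemma semivar_finite: "semivar Z < top"
proof (rule ccontr)
  assume "\<not> semivar Z < top"
  then have top: "semivar Z = top" by (metis top.not_eq_extremum)
  have "\<exists>C. \<forall>n. (C n \<in> MM \<and> semivar (C n) = top) \<and> C (Suc n) \<subseteq> C n \<and> semivar (C n - C (Suc n)) > 1"
  proof (rule dependent_nat_choice)
    show "\<exists>B. B \<in> MM \<and> semivar B = top" using top by blast
    fix B and n :: nat assume "B \<in> MM \<and> semivar B = top"
    then show "\<exists>C. (C \<in> MM \<and> semivar C = top) \<and> C \<subseteq> B \<and> semivar (B - C) > 1"
      using semivar_top_split[of B] by blast
  qed
  then obtain C where CS: "\<And>n. C (Suc n) \<subseteq> C n \<and> semivar (C n - C (Suc n)) > 1" by blast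
  have "decseq C" using CS by (intro decseq_SucI) auto
  have "disjoint_family (\<lambda>n. C n - C (Suc n))"
  proof -
    have "(C m - C (Suc m)) \<inter> (C n - C (Suc n)) = {}" if "m < n" for m n
      using decseqD[OF \<open>decseq C\<close>, of "Suc m" n] that by auto
    then show ?thesis unfolding disjoint_family_on_def by (metis Int_commute nat_neq_iff)
  qed
  from not_infinitely_many_large[OF this] CS show False by blast
qed

end

section \<open>The integral\<close>

text \<open>Since the range is countable, an arbitrary preimage is a countable union of level
  sets.\<close>

lemma S_space_measurable:
  assumes "sigma_algebra Z MM" and f: "f \<in> S_space Z MM"
  shows "f \<in> measurable (sigma Z MM) (count_space UNIV)"
proof -
  interpret sigma_algebra Z MM by fact
  show ?thesis
  proof (rule measurableI)
    fix U :: "'b set"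
    have "f -` U \<inter> Z = (\<Union>e\<in>U \<inter> f ` Z. f -` {e} \<inter> Z)" by auto
    also have "\<dots> \<in> MM" using f by (intro countable_UN') (auto simp: S_space_def)
    finally show "f -` U \<inter> space (sigma Z MM) \<in> sets (sigma Z MM)"
      by (simp add: space_measure_of_conv space_closed)
  qed simp
qed

lemma S_space_subset_M_space:
  assumes sa: "sigma_algebra Z MM" and f: "f \<in> S_space Z MM"
  shows "f \<in> M_space sE Z MM"
proof -
  have "(\<lambda>z. \<psi> (f z)) \<in> borel_measurable (sigma Z MM)" for \<psi> :: "'b \<Rightarrow>\<^sub>L 'c"
    using S_space_measurable[OF assms] by (rule measurable_compose) simp
  moreover have "separable_space (top_of_set (f ` Z))"
    unfolding separable_space_top_of_set_iff using f closure_subset[of "f ` Z"]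
    by (intro exI[of _ "f ` Z"]) (simp add: S_space_def)
  ultimately show ?thesis using f by (simp add: M_space_def S_space_def)
qed

text \<open>Pettis's argument: on a separable set the norm is the supremum of countably many functionals.\<close>

lemma M_space_norm_diff_le_measurable:
  fixes f :: "'z \<Rightarrow> 'e::banach"
  assumes sE: "banach_space_over sE" and f: "f \<in> M_space sE Z MM"
    and D: "countable D" "f ` Z \<subseteq> closure D"
  shows "{z \<in> Z. norm (f z - d) \<le> e} \<in> sets (sigma Z MM)"
proof -
  have "\<forall>x. \<exists>L :: 'e \<Rightarrow>\<^sub>L real. norm L \<le> 1 \<and> blinfun_apply L (x - d) = norm (x - d)"
    using norming_functional by blast
  then obtain L :: "'e \<Rightarrow> 'e \<Rightarrow>\<^sub>L real" where L: "\<And>x. norm (L x) \<le> 1" "\<And>x. blinfun_apply (L x) (x - d) = norm (x - d)"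
    by metis
  have Lle: "L x y \<le> norm y" for x y
  proof -
    have "L x y \<le> norm (L x) * norm y" using norm_blinfun[of "L x" y] by simp
    also have "\<dots> \<le> norm y" using L(1)[of x] by (simp add: mult_left_le_one_le)
    finally show ?thesis .
  qed
  have "norm (f z - d) \<le> e \<longleftrightarrow> (\<forall>x\<in>D. L x (f z) - L x d \<le> e)" if z: "z \<in> Z" for z
  proof
    assume "norm (f z - d) \<le> e"
    then show "\<forall>x\<in>D. L x (f z) - L x d \<le> e"
      using Lle[of _ "f z - d"] by (auto simp: blinfun.diff_right intro: order_trans)
  next
    assume *: "\<forall>x\<in>D. L x (f z) - L x d \<le> e"
    show "norm (f z - d) \<le> e"
    proof (rule field_le_epsilon)
      fix r :: real assume r: "r > 0"
      have "f z \<in> closure D" using D(2) z by blast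
      \<comment> \<open>\<open>L x\<close> is norming at \<open>x - d\<close> rather than at
        \<open>f z - d\<close>; passing between the two costs \<open>norm (f z - x)\<close> twice,
        hence \<open>r / 2\<close>.\<close>
      then obtain x where x: "x \<in> D" "dist x (f z) < r / 2"
        using r unfolding closure_approachable by (meson half_gt_zero)
      have "norm (f z - d) \<le> norm (f z - x) + norm (x - d)"
        using norm_triangle_ineq[of "f z - x" "x - d"] by simp
      also have "norm (x - d) = L x (f z - d) + L x (x - f z)"
        by (simp add: L(2)[symmetric] flip: blinfun.add_right)
      also have "L x (f z - d) \<le> e" using * x(1) by (simp add: blinfun.diff_right)
      also have "L x (x - f z) \<le> norm (x - f z)" by (rule Lle)
      finally show "norm (f z - d) \<le> e + r" using x(2) by (simp add: dist_norm norm_minus_commute)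
    qed
  qed
  then have "{z \<in> Z. norm (f z - d) \<le> e} = {z \<in> Z. \<forall>x\<in>D. L x (f z) - L x d \<le> e}" by blast
  also have "\<dots> = space (sigma Z MM) - (\<Union>x\<in>D. {z \<in> space (sigma Z MM). e < L x (f z) - L x d})"
    by (auto simp: space_measure_of_conv)
  also have "\<dots> \<in> sets (sigma Z MM)"
  proof -
    have "{z \<in> space (sigma Z MM). e < L x (f z) - L x d} \<in> sets (sigma Z MM)" for x
    proof -
      have "(\<lambda>z. L x (f z) - L x d) \<in> borel_measurable (sigma Z MM)"
        using M_space_real_functional_measurable[OF sE f, of "L x"] by (intro borel_measurable_diff) auto
      then show ?thesis by (intro borel_measurable_less) auto
    qed
    with D(1) show ?thesis by (intro sets.Diff sets.top sets.countable_UN') auto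
  qed
  finally show ?thesis .
qed

text \<open>\<open>s z\<close> is the first point in an enumeration of \<open>D\<close> within
  \<open>e\<close> of \<open>f z\<close>; taking the first makes the choice measurable, as it
  depends only on the sets where \<open>norm (f z - d k) \<le> e\<close>. Values in \<open>D\<close>
  matter later, where densities are known only along \<open>D\<close>.\<close>

lemma M_space_approx:
  fixes f :: "'z \<Rightarrow> 'e::banach"
  assumes sE: "banach_space_over sE" and sa: "sigma_algebra Z MM" and f: "f \<in> M_space sE Z MM"
    and D: "countable D" "f ` Z \<subseteq> closure D" and e: "e > 0"
  shows "\<exists>s\<in>S_space Z MM. s ` Z \<subseteq> D \<and> (\<forall>z\<in>Z. norm (s z - f z) \<le> e)"
proof (cases "D = {}")
  case True
  with D(2) have "Z = {}" by auto
  moreover from this sa have "f \<in> S_space Z MM"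
    by (simp add: S_space_def bounded_functions_def sigma_algebra.axioms(1) algebra_iff_Un sigma_algebra_iff)
  ultimately show ?thesis by (intro bexI[of _ f]) auto
next
  case False
  interpret sigma_algebra Z MM by fact
  define d where "d = from_nat_into D"
  have d: "range d = D" using False D(1) by (simp add: d_def)
  define s where "s z = d (LEAST k. norm (f z - d k) \<le> e)" for z
  have close: "norm (f z - s z) \<le> e" if "z \<in> Z" for z
  proof -
    have "f z \<in> closure D" using D(2) that by blast
    then obtain x where "x \<in> D" "dist x (f z) < e" using e unfolding closure_approachable by blast
    moreover from this obtain k where "x = d k" using d by blast
    ultimately have "norm (f z - d k) \<le> e" by (simp add: dist_norm norm_minus_commute)
    then show ?thesis unfolding s_def by (rule LeastI)
  qed
  have sD: "s z \<in> D" for z using d by (auto simp: s_def)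
  have sp: "space (sigma Z MM) = Z" and se: "sets (sigma Z MM) = MM"
    by (simp_all add: space_measure_of_conv space_closed)
  have "(\<lambda>z. LEAST k. norm (f z - d k) \<le> e) \<in> measurable (sigma Z MM) (count_space UNIV)"
    using M_space_norm_diff_le_measurable[OF sE f D] by (intro measurable_Least) (simp add: pred_def sp)
  then have "s \<in> measurable (sigma Z MM) (count_space UNIV)"
    unfolding s_def by (rule measurable_compose) simp
  from measurable_sets[OF this] have "s -` {y} \<inter> Z \<in> MM" for y by (simp add: sp se)
  moreover have "bounded (s ` Z)"
  proof -
    obtain C where C: "\<And>z. z \<in> Z \<Longrightarrow> norm (f z) \<le> C"
      using f by (auto simp: M_space_def bounded_functions_def bounded_iff)
    have "norm (s z) \<le> C + e" if "z \<in> Z" for z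
      using C[OF that] close[OF that] norm_triangle_ineq4[of "f z" "f z - s z"] by simp
    then show ?thesis by (intro boundedI[of _ "C + e"]) auto
  qed
  moreover have "countable (s ` Z)" using D(1) sD by (intro countable_subset[of "s ` Z" D]) auto
  ultimately have "s \<in> S_space Z MM" by (simp add: S_space_def bounded_functions_def)
  with sD close show ?thesis by (intro bexI[of _ s]) (auto simp: norm_minus_commute)
qed

section \<open>Construction and uniqueness of the continuous extension\<close>

context ind_measure begin

abbreviation total_semivar :: real where "total_semivar \<equiv> enn2real (semivar Z)"

lemma norm_sum_le_semivar:
  assumes J: "finite J" and A: "\<And>j. j \<in> J \<Longrightarrow> A j \<in> MM" and dis: "disjoint_family_on A J"
    and d: "d > 0" and x: "\<And>j. j \<in> J \<Longrightarrow> norm (x j) \<le> d"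
  shows "norm (\<Sum>j\<in>J. \<mu> (A j) (x j)) \<le> total_semivar * d"
proof -
  have "ennreal (norm (\<Sum>j\<in>J. \<mu> (A j) (inverse d *\<^sub>R x j))) \<le> semivar Z"
    using J A dis d x sets_into_space by (intro le_semivar) (auto simp: field_simps)
  then have "norm (\<Sum>j\<in>J. \<mu> (A j) (inverse d *\<^sub>R x j)) \<le> total_semivar"
    using semivar_finite enn2real_mono by fastforce
  also have "(\<Sum>j\<in>J. \<mu> (A j) (inverse d *\<^sub>R x j)) = inverse d *\<^sub>R (\<Sum>j\<in>J. \<mu> (A j) (x j))"
    by (simp add: blinfun.scaleR_right scaleR_sum_right)
  finally show ?thesis using d by (simp add: field_simps)
qed

lemma level_sets_inter:
  assumes "f \<in> S_space Z MM" and "g \<in> S_space Z MM"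
  shows "f -` {a} \<inter> g -` {b} \<inter> Z \<in> MM"
proof -
  have "f -` {a} \<inter> Z \<in> MM" "g -` {b} \<inter> Z \<in> MM" using assms by (auto simp: S_space_def)
  then have "(f -` {a} \<inter> Z) \<inter> (g -` {b} \<inter> Z) \<in> MM" by (rule Int)
  also have "(f -` {a} \<inter> Z) \<inter> (g -` {b} \<inter> Z) = f -` {a} \<inter> g -` {b} \<inter> Z" by blast
  finally show ?thesis .
qed

lemma simple_integral_has_sum:
  assumes f: "f \<in> S_space Z MM"
  shows "((\<lambda>a. \<mu> (f -` {a} \<inter> Z) a) has_sum simple_integral Z \<mu> f) (f ` Z)"
proof -
  have "(\<lambda>a. \<mu> (f -` {a} \<inter> Z) a) summable_on f ` Z"
  proof (rule summable_on_countable)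
    show "disjoint_family_on (\<lambda>a. f -` {a} \<inter> Z) (f ` Z)" by (auto simp: disjoint_family_on_def)
  qed (use f in \<open>auto simp: S_space_def bounded_functions_def\<close>)
  moreover have "simple_integral Z \<mu> f = (\<Sum>\<^sub>\<infinity>a\<in>f ` Z. \<mu> (f -` {a} \<inter> Z) a)"
    unfolding simple_integral_def
  proof (rule infsum_cong_neutral)
    fix a assume "a \<in> UNIV - f ` Z"
    then have "f -` {a} \<inter> Z = {}" by blast
    then show "\<mu> (f -` {a} \<inter> Z) a = 0" by simp
  qed auto
  ultimately show ?thesis by simp
qed

text \<open>Two integrals need a common index set before they can be subtracted. Splitting each
  level set of \<open>f\<close> by the values of \<open>g\<close> provides it, and unconditional
  summability over the pairs permits the iterated sum.\<close>

lemma simple_integral_refine: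
  assumes f: "f \<in> S_space Z MM" and g: "g \<in> S_space Z MM"
  shows "((\<lambda>p. \<mu> (f -` {fst p} \<inter> g -` {snd p} \<inter> Z) (fst p)) has_sum simple_integral Z \<mu> f) (f ` Z \<times> g ` Z)"
proof -
  let ?B = "\<lambda>p. f -` {fst p} \<inter> g -` {snd p} \<inter> Z"
  have B: "?B p \<in> MM" for p by (rule level_sets_inter[OF f g])
  have sum: "(\<lambda>p. \<mu> (?B p) (fst p)) summable_on f ` Z \<times> g ` Z"
  proof (rule summable_on_countable)
    show "disjoint_family_on ?B (f ` Z \<times> g ` Z)" by (auto simp: disjoint_family_on_def prod_eq_iff)
    show "bounded (fst ` (f ` Z \<times> g ` Z))"
      by (rule bounded_subset[of "f ` Z"]) (use f in \<open>auto simp: S_space_def bounded_functions_def\<close>)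
  qed (use f g B in \<open>auto simp: S_space_def\<close>)
  have "simple_integral Z \<mu> f = (\<Sum>\<^sub>\<infinity>a\<in>f ` Z. \<mu> (f -` {a} \<inter> Z) a)"
    using infsumI[OF simple_integral_has_sum[OF f]] by simp
  also have "\<dots> = (\<Sum>\<^sub>\<infinity>a\<in>f ` Z. \<Sum>\<^sub>\<infinity>b\<in>g ` Z. \<mu> (?B (a, b)) (fst (a, b)))"
  proof (rule infsum_cong)
    fix a
    have "((\<lambda>b. \<mu> (?B (a, b)) a) has_sum \<mu> (\<Union>b\<in>g ` Z. ?B (a, b)) a) (g ` Z)"
      using g B[of "(a, _)"] by (intro has_sum_countable) (auto simp: S_space_def disjoint_family_on_def)
    moreover have "(\<Union>b\<in>g ` Z. ?B (a, b)) = f -` {a} \<inter> Z" by auto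
    ultimately show "\<mu> (f -` {a} \<inter> Z) a = (\<Sum>\<^sub>\<infinity>b\<in>g ` Z. \<mu> (?B (a, b)) (fst (a, b)))"
      using infsumI by force
  qed
  also have "\<dots> = (\<Sum>\<^sub>\<infinity>p\<in>f ` Z \<times> g ` Z. \<mu> (?B p) (fst p))"
    using sum by (rule infsum_Sigma_banach)
  finally show ?thesis using has_sum_infsum[OF sum] by simp
qed

text \<open>On the common refinement the difference of the integrals is a sum with vectors
  \<open>fst p - snd p\<close>, and the semivariation bounds its finite partial sums
  uniformly.\<close>

lemma simple_integral_lipschitz:
  assumes f: "f \<in> S_space Z MM" and g: "g \<in> S_space Z MM"
    and d: "d > 0" and le: "\<And>z. z \<in> Z \<Longrightarrow> norm (f z - g z) \<le> d"
  shows "norm (simple_integral Z \<mu> f - simple_integral Z \<mu> g) \<le> total_semivar * d"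
proof -
  let ?J = "f ` Z \<times> g ` Z"
  let ?B = "\<lambda>p. f -` {fst p} \<inter> g -` {snd p} \<inter> Z"
  have B: "?B p \<in> MM" for p by (rule level_sets_inter[OF f g])
  have "((\<lambda>p. \<mu> (g -` {fst p} \<inter> f -` {snd p} \<inter> Z) (fst p)) has_sum simple_integral Z \<mu> g) (prod.swap ` ?J)"
    using simple_integral_refine[OF g f] by (simp add: product_swap)
  then have sg: "((\<lambda>p. \<mu> (?B p) (snd p)) has_sum simple_integral Z \<mu> g) ?J"
    by (subst (asm) has_sum_reindex) (auto simp: o_def Int_ac)
  have "((\<lambda>p. \<mu> (?B p) (fst p) + - \<mu> (?B p) (snd p)) has_sum simple_integral Z \<mu> f + - simple_integral Z \<mu> g) ?J"
    using simple_integral_refine[OF f g] sg by (intro has_sum_add) (simp_all add: has_sum_uminus)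
  then have lim: "(sum (\<lambda>p. \<mu> (?B p) (fst p - snd p)) \<longlongrightarrow> simple_integral Z \<mu> f - simple_integral Z \<mu> g)
      (finite_subsets_at_top ?J)"
    by (simp add: has_sum_def blinfun.diff_right)
  show ?thesis
  proof (rule tendsto_upperbound[OF tendsto_norm[OF lim]])
    have "norm (\<Sum>p\<in>G. \<mu> (?B p) (fst p - snd p)) \<le> total_semivar * d" if G: "finite G" for G
    proof -
      \<comment> \<open>Two values that are never taken at the same point may be far apart; setting
        the vector to 0 on such an empty cell makes the bound \<open>d\<close> hold for every
        index.\<close>
      have "(\<Sum>p\<in>G. \<mu> (?B p) (fst p - snd p)) = (\<Sum>p\<in>G. \<mu> (?B p) (if ?B p = {} then 0 else fst p - snd p))"
        by (intro sum.cong) auto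
      also have "norm \<dots> \<le> total_semivar * d"
      proof (rule norm_sum_le_semivar[OF G B _ d])
        show "disjoint_family_on ?B G" by (auto simp: disjoint_family_on_def prod_eq_iff)
        show "norm (if ?B p = {} then 0 else fst p - snd p) \<le> d" for p
        proof (cases "?B p = {}")
          case False
          then obtain z where "z \<in> Z" "f z = fst p" "g z = snd p" by auto
          with le[of z] have "norm (fst p - snd p) \<le> d" by simp
          with False show ?thesis by simp
        qed (use d in simp)
      qed
      finally show ?thesis .
    qed
    then show "\<forall>\<^sub>F G in finite_subsets_at_top ?J. norm (\<Sum>p\<in>G. \<mu> (?B p) (fst p - snd p)) \<le> total_semivar * d"
      by (intro eventually_finite_subsets_at_top_weakI) auto
  qed simp
qed

text \<open>Simple approximations with error \<open>1 / (n + 1)\<close> define the extension as a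
  limit. The Lipschitz estimate is exported alongside because \<open>continuous_extension\<close> by
  itself gives no rate.\<close>

lemma continuous_extension_exists:
  assumes sE: "banach_space_over sE"
  obtains I where "continuous_extension sE Z MM \<mu> I"
    and "\<And>f g d. f \<in> M_space sE Z MM \<Longrightarrow> g \<in> M_space sE Z MM \<Longrightarrow> d > 0 \<Longrightarrow>
      (\<And>z. z \<in> Z \<Longrightarrow> norm (f z - g z) \<le> d) \<Longrightarrow> norm (I f - I g) \<le> total_semivar * d"
proof -
  let ?K = total_semivar
  let ?SI = "simple_integral Z \<mu>"
  note sa = sigma_algebra_axioms
  define ap where "ap f n = (SOME s. s \<in> S_space Z MM \<and> (\<forall>z\<in>Z. norm (s z - f z) \<le> inverse (Suc n)))" 
    for f :: "'z \<Rightarrow> 'e" and n :: nat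
  have ap: "ap f n \<in> S_space Z MM \<and> (\<forall>z\<in>Z. norm (ap f n z - f z) \<le> inverse (Suc n))"
    if f: "f \<in> M_space sE Z MM" for f n
  proof -
    obtain D where D: "countable D" "f ` Z \<subseteq> closure D"
      using f by (auto simp: M_space_def separable_space_top_of_set_iff)
    have "inverse (real (Suc n)) > 0" by simp
    from M_space_approx[OF sE sa f D this]
    have "\<exists>s. s \<in> S_space Z MM \<and> (\<forall>z\<in>Z. norm (s z - f z) \<le> inverse (real (Suc n)))" by blast
    then show ?thesis unfolding ap_def by (rule someI_ex)
  qed
  define I where "I f = lim (\<lambda>n. ?SI (ap f n))" for f
  \<comment> \<open>Serves twice: with \<open>f = g\<close> and \<open>d = 0\<close> for the Cauchy
    property, with \<open>d > 0\<close> and \<open>m = n\<close> for the Lipschitz bound of the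
    limit.\<close>
  have lip: "norm (?SI (ap f m) - ?SI (ap g n)) \<le> ?K * (inverse (Suc m) + d + inverse (Suc n))"
    if f: "f \<in> M_space sE Z MM" and g: "g \<in> M_space sE Z MM" and d: "d \<ge> 0"
      and le: "\<And>z. z \<in> Z \<Longrightarrow> norm (f z - g z) \<le> d" for f g d m n
  proof (rule simple_integral_lipschitz)
    show "0 < inverse (real (Suc m)) + d + inverse (real (Suc n))"
      using d by (intro add_nonneg_pos add_nonneg_nonneg) auto
    fix z assume z: "z \<in> Z"
    have "ap f m z - ap g n z = (ap f m z - f z) + (f z - g z) - (ap g n z - g z)" by simp
    also have "norm \<dots> \<le> norm (ap f m z - f z) + norm (f z - g z) + norm (ap g n z - g z)"
      using norm_triangle_ineq4[of "(ap f m z - f z) + (f z - g z)" "ap g n z - g z"]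
        norm_triangle_ineq[of "ap f m z - f z" "f z - g z"] by linarith
    also have "\<dots> \<le> inverse (Suc m) + d + inverse (Suc n)"
      using ap[OF f, of m] ap[OF g, of n] le[OF z] z by (intro add_mono) auto
    finally show "norm (ap f m z - ap g n z) \<le> inverse (Suc m) + d + inverse (Suc n)" .
  qed (use ap f g in auto)
  have inv0: "(\<lambda>n. inverse (real (Suc n))) \<longlonglongrightarrow> 0" by (rule LIMSEQ_inverse_real_of_nat)
  have I: "(\<lambda>n. ?SI (ap f n)) \<longlonglongrightarrow> I f" if f: "f \<in> M_space sE Z MM" for f
  proof -
    have "Cauchy (\<lambda>n. ?SI (ap f n))"
    proof (rule CauchyI)
      fix e :: real assume e: "e > 0"
      have "(\<lambda>n. (2 * ?K) * inverse (real (Suc n))) \<longlonglongrightarrow> (2 * ?K) * 0" by (intro tendsto_intros inv0)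
      then have "\<forall>\<^sub>F n in sequentially. (2 * ?K) * inverse (real (Suc n)) < e"
        using e by (intro order_tendstoD) auto
      then obtain N where N: "(2 * ?K) * inverse (real (Suc N)) < e" by (auto simp: eventually_sequentially)
      have "norm (?SI (ap f m) - ?SI (ap f n)) < e" if "m \<ge> N" "n \<ge> N" for m n
      proof -
        have "norm (?SI (ap f m) - ?SI (ap f n)) \<le> ?K * (inverse (Suc m) + 0 + inverse (Suc n))"
          by (rule lip[OF f f]) auto
        also have "\<dots> \<le> ?K * (inverse (Suc N) + 0 + inverse (Suc N))"
          using that by (intro mult_left_mono add_mono le_imp_inverse_le) auto
        finally show ?thesis using N by simp
      qed
      then show "\<exists>M. \<forall>m\<ge>M. \<forall>n\<ge>M. norm (?SI (ap f m) - ?SI (ap f n)) < e" by blast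
    qed
    then show ?thesis unfolding I_def by (simp add: Cauchy_convergent_iff convergent_LIMSEQ_iff)
  qed
  have Ilip: "norm (I f - I g) \<le> ?K * d"
    if f: "f \<in> M_space sE Z MM" and g: "g \<in> M_space sE Z MM" and d: "d > 0"
      and le: "\<And>z. z \<in> Z \<Longrightarrow> norm (f z - g z) \<le> d" for f g d
  proof (rule LIMSEQ_le[OF tendsto_norm[OF tendsto_diff[OF I[OF f] I[OF g]]]])
    have "(\<lambda>n. ?K * (inverse (real (Suc n)) + d + inverse (real (Suc n)))) \<longlonglongrightarrow> ?K * (0 + d + 0)"
      by (intro tendsto_intros inv0)
    then show "(\<lambda>n. ?K * (inverse (real (Suc n)) + d + inverse (real (Suc n)))) \<longlonglongrightarrow> ?K * d" by simp
    show "\<exists>N. \<forall>n\<ge>N. norm (?SI (ap f n) - ?SI (ap g n)) \<le> ?K * (inverse (real (Suc n)) + d + inverse (real (Suc n)))"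
      using lip[OF f g less_imp_le[OF d] le] by blast
  qed
  have IS: "I f = ?SI f" if fS: "f \<in> S_space Z MM" for f
  proof -
    have f: "f \<in> M_space sE Z MM" by (rule S_space_subset_M_space[OF sa fS])
    have "norm (?SI (ap f n) - ?SI f) \<le> ?K * inverse (real (Suc n))" for n
      using ap[OF f, of n] fS by (intro simple_integral_lipschitz) auto
    moreover have "(\<lambda>n. ?K * inverse (real (Suc n))) \<longlonglongrightarrow> ?K * 0" by (intro tendsto_intros inv0)
    ultimately have "(\<lambda>n. ?SI (ap f n) - ?SI f) \<longlonglongrightarrow> 0"
      by (intro Lim_null_comparison[of "\<lambda>n. ?SI (ap f n) - ?SI f"]) auto
    then have "(\<lambda>n. ?SI (ap f n)) \<longlonglongrightarrow> ?SI f" by (simp add: LIM_zero_iff)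
    with I[OF f] show ?thesis by (rule LIMSEQ_unique)
  qed
  have "continuous_extension sE Z MM \<mu> I"
    unfolding continuous_extension_def
  proof (intro conjI ballI allI impI)
    fix f and e :: real assume f: "f \<in> M_space sE Z MM" and e: "e > 0"
    \<comment> \<open>Dividing by \<open>?K + 1\<close> also covers a measure of semivariation
      0.\<close>
    define d where "d = e / (?K + 1)"
    have K: "?K + 1 > 0" by (simp add: add_nonneg_pos)
    with e have d: "d > 0" by (simp add: d_def)
    have "?K * d < (?K + 1) * d" using d by simp
    also have "\<dots> = e" using K by (simp add: d_def)
    finally have "?K * d < e" .
    then have "norm (I g - I f) < e" if "g \<in> M_space sE Z MM" "\<forall>z\<in>Z. norm (g z - f z) \<le> d" for g
      using Ilip[OF that(1) f d] that(2) by fastforce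
    with d show "\<exists>d>0. \<forall>g\<in>M_space sE Z MM. (\<forall>z\<in>Z. norm (g z - f z) \<le> d) \<longrightarrow> norm (I g - I f) < e" by blast
  qed (use IS in auto)
  from this Ilip show thesis by (rule that)
qed

lemma continuous_extensionD:
  assumes "continuous_extension sE Z MM \<mu> I" and "f \<in> M_space sE Z MM" and "e > 0"
  shows "\<exists>d>0. \<forall>g\<in>M_space sE Z MM. (\<forall>z\<in>Z. norm (g z - f z) \<le> d) \<longrightarrow> norm (I g - I f) < e"
proof -
  from assms(1) have "\<forall>f\<in>M_space sE Z MM. \<forall>e>0. \<exists>d>0. \<forall>g\<in>M_space sE Z MM.
      (\<forall>z\<in>Z. norm (g z - f z) \<le> d) \<longrightarrow> norm (I g - I f) < e"
    unfolding continuous_extension_def by (rule conjunct2)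
  with assms(2,3) show ?thesis by simp
qed

text \<open>Both extensions agree on simple functions, which approximate \<open>f\<close> uniformly,
  and both are continuous at \<open>f\<close>.\<close>

lemma continuous_extension_unique:
  assumes sE: "banach_space_over sE" and I: "continuous_extension sE Z MM \<mu> I"
    and J: "continuous_extension sE Z MM \<mu> J" and f: "f \<in> M_space sE Z MM"
  shows "J f = I f"
proof -
  have "norm (J f - I f) \<le> 0"
  proof (rule field_le_epsilon)
    fix e :: real assume "e > 0"
    then have e2: "e / 2 > 0" by simp
    obtain d where d: "d > 0"
      "\<forall>g\<in>M_space sE Z MM. (\<forall>z\<in>Z. norm (g z - f z) \<le> d) \<longrightarrow> norm (I g - I f) < e / 2"
      using continuous_extensionD[OF I f e2] by (elim exE conjE)
    obtain d' where d': "d' > 0"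
      "\<forall>g\<in>M_space sE Z MM. (\<forall>z\<in>Z. norm (g z - f z) \<le> d') \<longrightarrow> norm (J g - J f) < e / 2"
      using continuous_extensionD[OF J f e2] by (elim exE conjE)
    obtain D where D: "countable D" "f ` Z \<subseteq> closure D"
      using f by (auto simp: M_space_def separable_space_top_of_set_iff)
    have "min d d' > 0" using d(1) d'(1) by simp
    from M_space_approx[OF sE sigma_algebra_axioms f D this]
    obtain s where sS: "s \<in> S_space Z MM" and s: "\<forall>z\<in>Z. norm (s z - f z) \<le> min d d'" by blast
    have sM: "s \<in> M_space sE Z MM" by (rule S_space_subset_M_space[OF sigma_algebra_axioms sS])
    have "\<forall>z\<in>Z. norm (s z - f z) \<le> d" "\<forall>z\<in>Z. norm (s z - f z) \<le> d'" using s by auto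
    with sM d(2) d'(2) have "norm (I s - I f) < e / 2" "norm (J s - J f) < e / 2" by blast+
    moreover have "J s = I s" using I J sS by (simp add: continuous_extension_def)
    ultimately show "norm (J f - I f) \<le> 0 + e"
      using norm_triangle_ineq4[of "I s - I f" "J s - J f"] by simp
  qed
  then show ?thesis by simp
qed

text \<open>All that later arguments use about \<open>integral_op\<close>: existence and uniqueness
  make the definite description meaningful and pass the Lipschitz bound on to it.\<close>

lemma integral_op_approx:
  assumes sE: "banach_space_over sE" and f: "f \<in> M_space sE Z MM" and s: "s \<in> S_space Z MM"
    and d: "d > 0" and le: "\<And>z. z \<in> Z \<Longrightarrow> norm (s z - f z) \<le> d"
  shows "norm (simple_integral Z \<mu> s - integral_op sE Z MM \<mu> f) \<le> total_semivar * d"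
proof -
  obtain I where I: "continuous_extension sE Z MM \<mu> I" and
    lip: "\<And>f g d. f \<in> M_space sE Z MM \<Longrightarrow> g \<in> M_space sE Z MM \<Longrightarrow> d > 0 \<Longrightarrow>
      (\<And>z. z \<in> Z \<Longrightarrow> norm (f z - g z) \<le> d) \<Longrightarrow> norm (I f - I g) \<le> total_semivar * d"
    using continuous_extension_exists[OF sE] by metis
  have "integral_op sE Z MM \<mu> f = I f"
    unfolding integral_op_def
  proof (rule the_equality)
    show "\<exists>J. continuous_extension sE Z MM \<mu> J \<and> J f = I f" using I by blast
  qed (use continuous_extension_unique[OF sE I _ f] in blast)
  moreover have "simple_integral Z \<mu> s = I s" using I s by (simp add: continuous_extension_def)
  ultimately show ?thesis
    using lip[OF S_space_subset_M_space[OF sigma_algebra_axioms s] f d le] by simp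
qed

end

section \<open>Representation of the integral by a weak density\<close>

lemma has_sum_imp_sums_from_nat_into:
  fixes F :: "'a \<Rightarrow> 'b::{comm_monoid_add, topological_space}"
  assumes R: "countable R" and F: "(F has_sum S) R"
  shows "(\<lambda>n. if n \<in> to_nat_on R ` R then F (from_nat_into R n) else 0) sums S"
proof -
  let ?G = "\<lambda>n. if n \<in> to_nat_on R ` R then F (from_nat_into R n) else 0"
  have "(?G \<circ> to_nat_on R has_sum S) R"
    using F by (rule has_sum_cong[THEN iffD1, rotated]) (use R in auto)
  then have "(?G has_sum S) (to_nat_on R ` R)" using R by (subst has_sum_reindex) auto
  then have "(?G has_sum S) UNIV"
    by (subst has_sum_cong_neutral[of "to_nat_on R ` R" UNIV ?G ?G]) auto
  then show ?thesis by (rule has_sum_imp_sums)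
qed

text \<open>The Radon-Nikodym theorem is applied to the nonnegative measure
  \<open>v = c * measure M + m\<close>, and \<open>c\<close> is subtracted from its density. Only
  the upper bound on \<open>h\<close> is recorded; the lower one returns later through the upper
  bound at the negative vector.\<close>

lemma signed_density:
  fixes m :: "'a set \<Rightarrow> real"
  assumes M: "finite_measure M" and le: "\<And>A. A \<in> sets M \<Longrightarrow> \<bar>m A\<bar> \<le> c * measure M A"
    and sums: "\<And>A. range A \<subseteq> sets M \<Longrightarrow> disjoint_family A \<Longrightarrow> (\<lambda>n. m (A n)) sums m (\<Union>n. A n)"
  obtains h where "integrable M h" and "\<And>A. A \<in> sets M \<Longrightarrow> set_lebesgue_integral M A h = m A"
    and "AE x in M. h x \<le> c"
proof -
  interpret finite_measure M by fact
  define v where "v A = c * measure M A + m A" for A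
  have v0: "0 \<le> v A" if "A \<in> sets M" for A using le[OF that] by (auto simp: v_def)
  have vsums: "(\<lambda>n. v (A n)) sums v (\<Union>n. A n)" if A: "range A \<subseteq> sets M" "disjoint_family A" for A
    unfolding v_def using A by (intro sums_add sums_mult finite_measure_UNION sums)
  define N where "N = measure_of (space M) (sets M) (\<lambda>A. ennreal (v A))"
  have sN: "sets N = sets M" "space N = space M" by (simp_all add: N_def)
  have N: "emeasure N A = ennreal (v A)" if "A \<in> sets M" for A
    unfolding N_def
  proof (rule emeasure_measure_of_sigma)
    show "sigma_algebra (space M) (sets M)" by (rule sets.sigma_algebra_axioms)
    have "m {} = 0" using le[of "{}"] by simp
    then show "positive (sets M) (\<lambda>A. ennreal (v A))" by (simp add: positive_def v_def)
    show "countably_additive (sets M) (\<lambda>A. ennreal (v A))"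
    proof (rule countably_additiveI)
      fix A :: "nat \<Rightarrow> 'a set" assume A: "range A \<subseteq> sets M" "disjoint_family A"
      then have "A n \<in> sets M" for n by blast
      then show "(\<Sum>n. ennreal (v (A n))) = ennreal (v (\<Union>n. A n))"
        using v0 vsums[OF A] by (intro suminf_ennreal_eq) auto
    qed
  qed (rule that)
  have ac: "absolutely_continuous M N"
    unfolding absolutely_continuous_def
  proof
    fix A assume A: "A \<in> null_sets M"
    then have "measure M A = 0" "A \<in> sets M" by (auto simp: measure_def)
    then have "v A = 0" using le[of A] by (simp add: v_def)
    with N[of A] A show "A \<in> null_sets N" by (auto simp: null_sets_def sN)
  qed
  obtain k where k: "k \<in> borel_measurable M" "density M k = N" using Radon_Nikodym[OF ac sN(1)] by blast
  have kA: "(\<integral>\<^sup>+x. k x * indicator A x \<partial>M) = ennreal (v A)" if "A \<in> sets M" for A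
    using emeasure_density[OF k(1) that] N[OF that] k(2) by simp
  have "(\<integral>\<^sup>+x. k x \<partial>M) = (\<integral>\<^sup>+x. k x * indicator (space M) x \<partial>M)" by (intro nn_integral_cong) auto
  then have "(\<integral>\<^sup>+x. k x \<partial>M) \<noteq> \<infinity>" using kA[of "space M"] by simp
  then have kfin: "AE x in M. k x \<noteq> \<infinity>" by (intro nn_integral_noteq_infinite k)
  \<comment> \<open>\<open>k\<close> is finite almost everywhere because its integral
    \<open>v (space M)\<close> is finite, so \<open>enn2real\<close> alters it only on a null
    set.\<close>
  define h where "h x = enn2real (k x) - c" for x
  have kint: "integrable M (\<lambda>x. enn2real (k x) * indicator A x)"
    "(LINT x|M. enn2real (k x) * indicator A x) = v A" if A: "A \<in> sets M" for A
  proof -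
    have "(\<integral>\<^sup>+x. ennreal (enn2real (k x) * indicator A x) \<partial>M) = (\<integral>\<^sup>+x. k x * indicator A x \<partial>M)"
      using kfin by (intro nn_integral_cong_AE) (auto elim!: eventually_mono simp: less_top indicator_def)
    then have eq: "(\<integral>\<^sup>+x. ennreal (enn2real (k x) * indicator A x) \<partial>M) = ennreal (v A)" using kA[OF A] by simp
    have "has_bochner_integral M (\<lambda>x. enn2real (k x) * indicator A x) (v A)"
      using A k(1) v0[OF A] eq by (intro has_bochner_integral_nn_integral) auto
    then show "integrable M (\<lambda>x. enn2real (k x) * indicator A x)"
      "(LINT x|M. enn2real (k x) * indicator A x) = v A"
      by (auto simp: has_bochner_integral_iff)
  qed
  have "integrable M (\<lambda>x. enn2real (k x) * indicator (space M) x)" using kint(1) by blast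
  then have ik: "integrable M (\<lambda>x. enn2real (k x))"
    by (rule Bochner_Integration.integrable_cong[THEN iffD1, rotated -1]) auto
  then have ih: "integrable M h" unfolding h_def by auto
  have ind: "integrable M (\<lambda>x. c * indicator A x)" if "A \<in> sets M" for A
    using that by (intro integrable_mult_right integrable_real_indicator) (auto simp: less_top[symmetric])
  have hA: "set_lebesgue_integral M A h = m A" if A: "A \<in> sets M" for A
  proof -
    have "set_lebesgue_integral M A h = (LINT x|M. enn2real (k x) * indicator A x - c * indicator A x)"
      unfolding set_lebesgue_integral_def h_def by (intro Bochner_Integration.integral_cong) (auto simp: algebra_simps)
    also have "\<dots> = v A - c * measure M A"
      using kint[OF A] ind[OF A] A by (subst Bochner_Integration.integral_diff) auto
    finally show ?thesis by (simp add: v_def)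
  qed
  have "AE x in M. 0 \<le> c - h x"
  proof (rule density_nonneg)
    show "integrable M (\<lambda>x. c - h x)" using ih by auto
    fix A assume A: "A \<in> sets M"
    have "(LINT x:A|M. c - h x) = c * measure M A - m A"
    proof -
      have "(LINT x:A|M. c - h x) = (LINT x|M. c * indicator A x - indicator A x * h x)"
        unfolding set_lebesgue_integral_def by (intro Bochner_Integration.integral_cong) (auto simp: algebra_simps)
      also have "\<dots> = c * measure M A - m A"
        using A ind[OF A] hA[OF A] integrable_mult_indicator[OF A ih]
        by (subst Bochner_Integration.integral_diff) (auto simp: set_lebesgue_integral_def)
      finally show ?thesis .
    qed
    then show "0 \<le> (LINT x:A|M. c - h x)" using le[OF A] by simp
  qed
  then have "AE x in M. h x \<le> c" by (auto elim: eventually_mono)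
  with ih hA show thesis by (rule that)
qed

section \<open>The semivariation of a real-valued measure as a measure, and its densities\<close>

locale real_ind_measure = ind_measure Z MM \<nu>
  for Z :: "'z set" and MM and \<nu> :: "'z set \<Rightarrow> 'e::banach \<Rightarrow>\<^sub>L real"
begin

text \<open>Each of two admissible systems can be multiplied by the sign of its own sum without
  leaving the unit ball. Then both sums are nonnegative, and the concatenated system attains the sum
  of their norms. This is where scalar values enter.\<close>

lemma semivar_superadditive:
  assumes "A \<inter> B = {}"
  shows "semivar A + semivar B \<le> semivar (A \<union> B)"
proof -
  have ne: "admissible C \<noteq> {}" for C by (auto simp: admissible_def disjoint_family_on_def intro!: exI[of _ 0])
  let ?v = "\<lambda>p. case p of (N, A, x) \<Rightarrow> ennreal (norm (\<Sum>k<N. \<nu> (A k) (x k)))"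
  have *: "?v p + ?v q \<le> semivar (A \<union> B)" if pq: "p \<in> admissible A" "q \<in> admissible B" for p q
  proof -
    obtain N A' x where p: "p = (N, A', x)" by (metis prod.exhaust)
    obtain M B' y where q: "q = (M, B', y)" by (metis prod.exhaust)
    note a = admissibleD[OF pq(1)[unfolded p]] and b = admissibleD[OF pq(2)[unfolded q]]
    define r where "r u = (if u < 0 then - 1 else 1 :: real)" for u :: real
    have r: "r u * u = \<bar>u\<bar>" "\<bar>r u\<bar> = 1" for u by (auto simp: r_def)
    let ?s = "\<Sum>k<N. \<nu> (A' k) (x k)" and ?t = "\<Sum>k<M. \<nu> (B' k) (y k)"
    let ?J = "{..<N} <+> {..<M}"
    let ?C = "case_sum A' B'" and ?w = "case_sum (\<lambda>k. r ?s *\<^sub>R x k) (\<lambda>k. r ?t *\<^sub>R y k)"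
    have "disjoint_family_on ?C ?J"
      unfolding disjoint_family_on_def
    proof (intro ballI impI)
      fix i j assume ij: "i \<in> ?J" "j \<in> ?J" "i \<noteq> j"
      have "A' k \<inter> B' l = {}" if "k < N" "l < M" for k l using a(2) b(2) that assms by blast
      moreover from this have "B' l \<inter> A' k = {}" if "k < N" "l < M" for k l using that by blast
      moreover have "A' k \<inter> A' l = {}" if "k < N" "l < N" "k \<noteq> l" for k l
        using a(4) that by (auto simp: disjoint_family_on_def)
      moreover have "B' k \<inter> B' l = {}" if "k < M" "l < M" "k \<noteq> l" for k l
        using b(4) that by (auto simp: disjoint_family_on_def)
      ultimately show "?C i \<inter> ?C j = {}" using ij by (elim PlusE) simp_all
    qed
    then have "ennreal (norm (\<Sum>j\<in>?J. \<nu> (?C j) (?w j))) \<le> semivar (A \<union> B)"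
      using a(1,3) b(1,3) r(2) by (intro le_semivar) (auto dest: subsetD[OF a(2)] subsetD[OF b(2)])
    also have "(\<Sum>j\<in>?J. \<nu> (?C j) (?w j)) = (\<Sum>k<N. r ?s * \<nu> (A' k) (x k)) + (\<Sum>k<M. r ?t * \<nu> (B' k) (y k))"
      by (simp add: sum.Plus blinfun.scaleR_right)
    also have "\<dots> = \<bar>?s\<bar> + \<bar>?t\<bar>" by (simp add: r(1) flip: sum_distrib_left)
    finally show ?thesis by (simp add: p q ennreal_plus[symmetric] del: ennreal_plus)
  qed
  have "semivar A + semivar B = (SUP p\<in>admissible A. ?v p + semivar B)"
    unfolding semivar_def[of A] using ne by (rule ennreal_SUP_add_left[symmetric])
  also have "\<dots> \<le> semivar (A \<union> B)"
  proof (rule SUP_least)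
    fix p assume p: "p \<in> admissible A"
    have "semivar B + ?v p = (SUP q\<in>admissible B. ?v q + ?v p)"
      unfolding semivar_def[of B] using ne by (rule ennreal_SUP_add_left[symmetric])
    then have "?v p + semivar B = (SUP q\<in>admissible B. ?v p + ?v q)" by (simp add: add.commute)
    also have "\<dots> \<le> semivar (A \<union> B)" by (rule SUP_least) (rule *[OF p])
    finally show "?v p + semivar B \<le> semivar (A \<union> B)" .
  qed
  finally show ?thesis .
qed

definition variation :: "'z measure" where
  "variation = measure_of Z MM semivar"

lemma space_variation [simp]: "space variation = Z"
  and sets_variation [simp]: "sets variation = MM"
  by (simp_all add: variation_def space_measure_of_conv space_closed)

text \<open>Finite superadditivity with monotonicity gives one inequality of countable additivity,
  countable subadditivity the other.\<close>

lemma emeasure_variation: "A \<in> MM \<Longrightarrow> emeasure variation A = semivar A"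
  unfolding variation_def
proof (rule emeasure_measure_of_sigma)
  show "positive MM semivar" by (simp add: positive_def)
  show "countably_additive MM semivar"
  proof (rule countably_additiveI)
    fix A :: "nat \<Rightarrow> 'z set" assume A: "range A \<subseteq> MM" "disjoint_family A"
    have "(\<Sum>i<n. semivar (A i)) \<le> semivar (\<Union>i<n. A i)" for n
    proof (induction n)
      case (Suc n)
      have "A n \<inter> A i = {}" if "i < n" for i using A(2) that by (auto simp: disjoint_family_on_def)
      then have "A n \<inter> (\<Union>i<n. A i) = {}" by blast
      then have "semivar (A n) + semivar (\<Union>i<n. A i) \<le> semivar (\<Union>i<Suc n. A i)"
        using semivar_superadditive by (simp add: lessThan_Suc)
      with Suc show ?case by (simp add: add.commute) (meson add_left_mono order_trans)
    qed simp
    also have "semivar (\<Union>i<n. A i) \<le> semivar (\<Union>i. A i)" for n by (rule semivar_mono) blast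
    finally have "(\<Sum>i. semivar (A i)) \<le> semivar (\<Union>i. A i)" by (intro suminf_le_const) auto
    then show "(\<Sum>i. semivar (A i)) = semivar (\<Union>i. A i)"
      using semivar_countably_subadditive[OF A] by (rule antisym)
  qed
qed (rule sigma_algebra_axioms)

lemma finite_measure_variation: "finite_measure variation"
  using semivar_finite by (intro finite_measureI) (simp add: emeasure_variation)

lemma abs_le_variation:
  assumes A: "A \<in> MM"
  shows "\<bar>\<nu> A x\<bar> \<le> norm x * measure variation A"
proof (cases "x = 0")
  case False
  have "ennreal (norm (\<nu> A (inverse (norm x) *\<^sub>R x))) \<le> semivar A"
    using False by (intro norm_le_semivar[OF A]) auto
  also have "\<dots> = ennreal (measure variation A)"
    using finite_measure.emeasure_eq_measure[OF finite_measure_variation] emeasure_variation[OF A] by metis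
  finally have "norm (\<nu> A (inverse (norm x) *\<^sub>R x)) \<le> measure variation A" by simp
  then show ?thesis using False by (simp add: blinfun.scaleR_right abs_mult field_simps)
qed simp

text \<open>Each \<open>x\<close> in a countable rational subspace \<open>D\<close> has a Radon-Nikodym density of
  \<open>A \<mapsto> \<nu> A x\<close>. Off one common null set these densities are rationally linear in \<open>x\<close> and
  dominated by the norm, so they extend to functionals by the Hahn-Banach theorem.\<close>

lemma functional_density:
  assumes D: "countable D" "rational_subspace D"
  obtains l :: "'z \<Rightarrow> 'e \<Rightarrow>\<^sub>L real" where "\<And>z. norm (l z) \<le> 1"
    and "\<And>d. d \<in> D \<Longrightarrow> (\<lambda>z. l z d) \<in> borel_measurable variation"
    and "\<And>d A. d \<in> D \<Longrightarrow> A \<in> MM \<Longrightarrow> (LINT z:A|variation. l z d) = \<nu> A d"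
proof -
  interpret V: finite_measure variation by (rule finite_measure_variation)
  have "\<exists>h. integrable variation h \<and> (\<forall>A\<in>MM. set_lebesgue_integral variation A h = \<nu> A x) \<and>
      (AE z in variation. h z \<le> norm x)" for x
    using signed_density[OF V.finite_measure_axioms, of "\<lambda>A. \<nu> A x" "norm x"] abs_le_variation sums
    by (metis sets_variation)
  then obtain h where hi: "\<And>x. integrable variation (h x)"
    and hA: "\<And>x A. A \<in> MM \<Longrightarrow> set_lebesgue_integral variation A (h x) = \<nu> A x"
    and hle: "\<And>x. AE z in variation. h x z \<le> norm x"
    by metis
  \<comment> \<open>By linearity of \<open>\<nu> A\<close> both sides have the same integral over
    every measurable set, and such densities agree almost everywhere.\<close>
  have hlin: "AE z in variation. h (x + q *\<^sub>R y) z = h x z + q * h y z" for x y q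
  proof (rule density_unique_real)
    show "integrable variation (\<lambda>z. h x z + q * h y z)" using hi by auto
    fix A assume "A \<in> sets variation"
    then have A: "A \<in> MM" by simp
    have si: "set_integrable variation A (h x)" for x
      unfolding set_integrable_def using A hi by (intro integrable_mult_indicator) auto
    have "(LINT z:A|variation. h x z + q * h y z) = \<nu> A x + q * \<nu> A y"
      using si by (simp add: set_integral_add hA[OF A])
    then show "(LINT z:A|variation. h (x + q *\<^sub>R y) z) = (LINT z:A|variation. h x z + q * h y z)"
      by (simp add: hA[OF A] blinfun.add_right blinfun.scaleR_right)
  qed (rule hi)
  have countable_Rats: "countable (\<rat> :: real set)" by (rule countable_rat)
  have ae: "AE z in variation. (\<forall>x\<in>D. h x z \<le> norm x) \<and>
      (\<forall>x\<in>D. \<forall>y\<in>D. \<forall>q\<in>\<rat>. h (x + q *\<^sub>R y) z = h x z + q * h y z)"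
    using hle hlin D(1) countable_Rats by (simp add: AE_ball_countable)
  obtain N where good: "\<And>z. z \<in> space variation - N \<Longrightarrow> (\<forall>x\<in>D. h x z \<le> norm x) \<and>
      (\<forall>x\<in>D. \<forall>y\<in>D. \<forall>q\<in>\<rat>. h (x + q *\<^sub>R y) z = h x z + q * h y z)"
    and N: "N \<in> null_sets variation"
    by (rule AE_E3[OF ae]) (rule that)
  \<comment> \<open>The values of \<open>L\<close> on \<open>D\<close> are prescribed, so an
    arbitrary choice of the extension leaves \<open>z \<mapsto> l z d\<close> equal to
    \<open>h d\<close>, cut off to 0 on the measurable null set \<open>N\<close>.\<close>
  have "\<exists>L :: 'e \<Rightarrow>\<^sub>L real. norm L \<le> 1 \<and> (\<forall>x\<in>D. blinfun_apply L x = (if z \<in> Z - N then h x z else 0))" for z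
  proof (cases "z \<in> Z - N")
    case True
    note g = good[unfolded space_variation, OF True]
    obtain L :: "'e \<Rightarrow>\<^sub>L real" where "norm L \<le> 1" "\<And>x. x \<in> D \<Longrightarrow> L x = h x z"
      using Hahn_Banach_rational_subspace[OF D(2), of "\<lambda>x. h x z"] g by blast
    then show ?thesis using True by (intro exI[of _ L]) auto
  next
    case False
    then show ?thesis by (intro exI[of _ 0]) auto
  qed
  then obtain l :: "'z \<Rightarrow> 'e \<Rightarrow>\<^sub>L real" where l: "\<And>z. norm (l z) \<le> 1"
    "\<And>z x. x \<in> D \<Longrightarrow> l z x = (if z \<in> Z - N then h x z else 0)"
    by metis
  have NM: "N \<in> sets variation" using N by auto
  have lm: "(\<lambda>z. l z d) \<in> borel_measurable variation" if d: "d \<in> D" for d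
  proof -
    have "(\<lambda>z. if z \<in> N then 0 else h d z) \<in> borel_measurable variation"
      using NM hi[of d] by (intro measurable_If_set) auto
    then show ?thesis
      by (rule measurable_cong[THEN iffD1, rotated]) (auto simp: l(2)[OF d])
  qed
  have "(LINT z:A|variation. l z d) = \<nu> A d" if d: "d \<in> D" and A: "A \<in> MM" for d A
  proof -
    have "AE z in variation. z \<notin> N" using N by (rule AE_not_in)
    then have "(LINT z:A|variation. l z d) = set_lebesgue_integral variation A (h d)"
      using A lm[OF d] hi[of d] sets_into_space[OF A]
      by (intro set_lebesgue_integral_cong_AE) (auto elim!: eventually_mono simp: l(2)[OF d])
    then show ?thesis using hA[OF A] by simp
  qed
  with l(1) lm show thesis by (rule that)
qed

text \<open>On a level set of \<open>s\<close> the integrand is \<open>l z d\<close> for one fixed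
  \<open>d\<close> in \<open>D\<close>, so \<open>lA\<close> evaluates its integral as
  \<open>\<nu> A d\<close>; countable additivity of the Lebesgue integral sums these to the series
  that defines the simple integral.\<close>

lemma integral_simple_eq:
  assumes l: "\<And>z. norm (l z) \<le> 1"
    and lm: "\<And>d. d \<in> D \<Longrightarrow> (\<lambda>z. blinfun_apply (l z) d) \<in> borel_measurable variation"
    and lA: "\<And>d A. d \<in> D \<Longrightarrow> A \<in> MM \<Longrightarrow> (LINT z:A|variation. blinfun_apply (l z) d) = \<nu> A d"
    and s: "s \<in> S_space Z MM" and sD: "s ` Z \<subseteq> D"
  shows "(\<lambda>z. l z (s z)) \<in> borel_measurable variation"
    and "(LINT z|variation. l z (s z)) = simple_integral Z \<nu> s"
proof -
  interpret V: finite_measure variation by (rule finite_measure_variation)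
  let ?R = "s ` Z"
  have R: "countable ?R" using s by (simp add: S_space_def)
  have level: "s -` {e} \<inter> Z \<in> MM" for e using s by (simp add: S_space_def)
  show m: "(\<lambda>z. l z (s z)) \<in> borel_measurable variation"
  proof (rule measurable_compose_countable'[of ?R "\<lambda>d z. l z d"])
    show "s \<in> measurable variation (count_space ?R)"
    proof (rule measurableI)
      fix U
      show "s -` U \<inter> space variation \<in> sets variation"
        using measurable_sets[OF S_space_measurable[OF sigma_algebra_axioms s], of U]
        by (simp add: space_measure_of_conv space_closed)
    qed simp
  qed (use lm sD R in auto)
  obtain C where C: "\<And>z. z \<in> Z \<Longrightarrow> norm (s z) \<le> C"
    using s by (auto simp: S_space_def bounded_functions_def bounded_iff)
  have bd: "norm (l z (s z)) \<le> C" if "z \<in> Z" for z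
  proof -
    have "norm (l z (s z)) \<le> norm (l z) * norm (s z)" by (rule norm_blinfun)
    also have "\<dots> \<le> norm (s z)" using l[of z] by (simp add: mult_left_le_one_le)
    finally show ?thesis using C[OF that] by linarith
  qed
  have int: "integrable variation (\<lambda>z. l z (s z))"
    using m bd by (intro V.integrable_const_bound[of _ C]) auto
  define A where "A n = (if n \<in> to_nat_on ?R ` ?R then s -` {from_nat_into ?R n} \<inter> Z else {})" for n
  have AM: "A n \<in> MM" for n using level by (auto simp: A_def)
  have dis: "disjoint_family A"
    unfolding A_def using R by (intro disjoint_family_from_nat_into[where A = "\<lambda>e. s -` {e} \<inter> Z"])
      (auto simp: disjoint_family_on_def)
  have UA: "(\<Union>n. A n) = Z"
  proof
    show "Z \<subseteq> (\<Union>n. A n)"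
    proof
      fix z assume z: "z \<in> Z"
      then have "z \<in> A (to_nat_on ?R (s z))" using R by (simp add: A_def)
      then show "z \<in> (\<Union>n. A n)" by blast
    qed
  qed (auto simp: A_def split: if_splits)
  have "(LINT z|variation. l z (s z)) = (LINT z:(\<Union>n. A n)|variation. l z (s z))"
    unfolding UA set_lebesgue_integral_def by (intro Bochner_Integration.integral_cong) auto
  also have "\<dots> = (\<Sum>n. LINT z:A n|variation. l z (s z))"
  proof (rule lebesgue_integral_countable_add)
    show "A i \<inter> A j = {}" if "i \<noteq> j" for i j using dis that by (auto simp: disjoint_family_on_def)
    show "set_integrable variation (\<Union>n. A n) (\<lambda>z. l z (s z))"
      unfolding set_integrable_def UA using int by (intro integrable_mult_indicator) auto
  qed (use AM in auto)
  also have "(\<lambda>n. LINT z:A n|variation. l z (s z)) =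
      (\<lambda>n. if n \<in> to_nat_on ?R ` ?R then \<nu> (s -` {from_nat_into ?R n} \<inter> Z) (from_nat_into ?R n) else 0)"
  proof
    fix n
    show "(LINT z:A n|variation. l z (s z)) =
      (if n \<in> to_nat_on ?R ` ?R then \<nu> (s -` {from_nat_into ?R n} \<inter> Z) (from_nat_into ?R n) else 0)"
    proof (cases "n \<in> to_nat_on ?R ` ?R")
      case True
      let ?d = "from_nat_into ?R n"
      have "?d \<in> ?R" using True R by auto
      then have dD: "?d \<in> D" using sD by blast
      have An: "A n = s -` {?d} \<inter> Z" using True by (simp add: A_def)
      have "(LINT z:A n|variation. l z (s z)) = (LINT z:A n|variation. l z ?d)"
        unfolding set_lebesgue_integral_def
        by (intro Bochner_Integration.integral_cong refl) (auto simp: An indicator_def)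
      with lA[OF dD AM[of n]] True show ?thesis by (simp add: An)
    qed (simp add: A_def set_lebesgue_integral_def)
  qed
  also have "(\<Sum>n. if n \<in> to_nat_on ?R ` ?R then \<nu> (s -` {from_nat_into ?R n} \<inter> Z) (from_nat_into ?R n) else 0)
      = simple_integral Z \<nu> s"
    using has_sum_imp_sums_from_nat_into[OF R simple_integral_has_sum[OF s]] by (rule sums_unique[symmetric])
  finally show "(LINT z|variation. l z (s z)) = simple_integral Z \<nu> s" .
qed

end

section \<open>Scalar representation of the vector integral\<close>

lemma (in ind_measure) real_ind_measure_compose:
  fixes \<phi> :: "'f \<Rightarrow>\<^sub>L real"
  shows "real_ind_measure Z MM (\<lambda>A. \<phi> o\<^sub>L \<mu> A)"
proof unfold_locales
  fix A :: "nat \<Rightarrow> 'z set" assume A: "range A \<subseteq> MM" "disjoint_family A"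
  show "(\<lambda>n. (\<phi> o\<^sub>L \<mu> (A n)) x) sums (\<phi> o\<^sub>L \<mu> (\<Union>n. A n)) x" for x
    using bounded_linear.sums[OF blinfun.bounded_linear_right sums[OF A, of x], of \<phi>] by simp
  have "summable (\<lambda>n. (\<phi> o\<^sub>L \<mu> (A n)) (x n))" if "bounded (range x)" for x
  proof -
    have "summable (\<lambda>n. \<mu> (A n) (x n))" using indep[OF A] that by (simp add: independently_convergent_def)
    from bounded_linear.summable[OF blinfun.bounded_linear_right this, of \<phi>] show ?thesis by simp
  qed
  then show "independently_convergent (\<lambda>n. \<phi> o\<^sub>L \<mu> (A n))" by (simp add: independently_convergent_def)
qed

text \<open>\<open>M\<close> and \<open>l\<close> depend on \<open>\<phi>\<close> and
  \<open>D\<close> but not on \<open>f\<close>, so one representation serves a whole sequence. The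
  identity holds for simple functions with values in \<open>D\<close> and passes to \<open>f\<close>
  along uniform approximations: the left side by the Lipschitz bound, the right side by dominated
  convergence.\<close>

lemma (in ind_measure) functional_integral_op_eq:
  fixes \<phi> :: "'f \<Rightarrow>\<^sub>L real"
  assumes sE: "banach_space_over sE" and D: "countable D" "rational_subspace D"
  obtains M and l :: "'z \<Rightarrow> 'e \<Rightarrow>\<^sub>L real" where "finite_measure M" and "space M = Z" and "\<And>z. norm (l z) \<le> 1"
    and "\<And>f. f \<in> M_space sE Z MM \<Longrightarrow> f ` Z \<subseteq> closure D \<Longrightarrow> (\<lambda>z. l z (f z)) \<in> borel_measurable M"
    and "\<And>f. f \<in> M_space sE Z MM \<Longrightarrow> f ` Z \<subseteq> closure D \<Longrightarrow>
      \<phi> (integral_op sE Z MM \<mu> f) = (LINT z|M. l z (f z))"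
proof -
  interpret N: real_ind_measure Z MM "\<lambda>A. \<phi> o\<^sub>L \<mu> A" by (rule real_ind_measure_compose)
  interpret V: finite_measure N.variation by (rule N.finite_measure_variation)
  obtain l :: "'z \<Rightarrow> 'e \<Rightarrow>\<^sub>L real" where l: "\<And>z. norm (l z) \<le> 1"
    and lm: "\<And>d. d \<in> D \<Longrightarrow> (\<lambda>z. l z d) \<in> borel_measurable N.variation"
    and lA: "\<And>d A. d \<in> D \<Longrightarrow> A \<in> MM \<Longrightarrow> (LINT z:A|N.variation. l z d) = (\<phi> o\<^sub>L \<mu> A) d"
    using N.functional_density[OF D] by blast
  have lle: "norm (l z x) \<le> norm x" for z x
  proof -
    have "norm (l z x) \<le> norm (l z) * norm x" by (rule norm_blinfun)
    also have "\<dots> \<le> norm x" using l[of z] by (simp add: mult_left_le_one_le)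
    finally show ?thesis .
  qed
  have main: "(\<lambda>z. l z (f z)) \<in> borel_measurable N.variation \<and>
      \<phi> (integral_op sE Z MM \<mu> f) = (LINT z|N.variation. l z (f z))"
    if f: "f \<in> M_space sE Z MM" and fD: "f ` Z \<subseteq> closure D" for f
  proof -
    have "\<forall>n. \<exists>s. s \<in> S_space Z MM \<and> s ` Z \<subseteq> D \<and> (\<forall>z\<in>Z. norm (s z - f z) \<le> inverse (real (Suc n)))"
      using M_space_approx[OF sE sigma_algebra_axioms f D(1) fD] by (metis inverse_positive_iff_positive of_nat_0_less_iff zero_less_Suc)
    then obtain s where s: "\<And>n. s n \<in> S_space Z MM" "\<And>n. s n ` Z \<subseteq> D"
      and close: "\<And>n z. z \<in> Z \<Longrightarrow> norm (s n z - f z) \<le> inverse (real (Suc n))" by metis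
    note ls = N.integral_simple_eq[OF l lm lA s]
    have inv0: "(\<lambda>n. inverse (real (Suc n))) \<longlonglongrightarrow> 0" by (rule LIMSEQ_inverse_real_of_nat)
    have lim: "(\<lambda>n. l z (s n z)) \<longlonglongrightarrow> l z (f z)" if z: "z \<in> Z" for z
    proof -
      have "(\<lambda>n. s n z - f z) \<longlonglongrightarrow> 0"
        using close[OF z] inv0 by (intro Lim_null_comparison[of "\<lambda>n. s n z - f z"]) auto
      then have "(\<lambda>n. s n z) \<longlonglongrightarrow> f z" by (simp add: LIM_zero_iff)
      then show ?thesis by (intro tendsto_intros)
    qed
    have m: "(\<lambda>z. l z (f z)) \<in> borel_measurable N.variation"
      by (rule borel_measurable_LIMSEQ_real[where u = "\<lambda>n z. l z (s n z)"]) (simp_all add: lim ls(1))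
    obtain C where C: "\<And>z. z \<in> Z \<Longrightarrow> norm (f z) \<le> C"
      using f by (auto simp: M_space_def bounded_functions_def bounded_iff)
    \<comment> \<open>The extra 1 is the largest permitted approximation error
      \<open>inverse (Suc n)\<close>, the one at \<open>n = 0\<close>.\<close>
    have "norm (l z (s n z)) \<le> C + 1" if z: "z \<in> Z" for n z
    proof -
      have "norm (l z (s n z)) \<le> norm (s n z)" by (rule lle)
      also have "\<dots> \<le> norm (f z) + norm (s n z - f z)" using norm_triangle_ineq[of "f z" "s n z - f z"] by simp
      also have "\<dots> \<le> C + 1"
        using C[OF z] close[OF z, of n] by (intro add_mono) (auto intro: order_trans simp: inverse_le_1_iff)
      finally show ?thesis .
    qed
    then have "(\<lambda>n. LINT z|N.variation. l z (s n z)) \<longlonglongrightarrow> (LINT z|N.variation. l z (f z))"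
      using m ls(1) lim by (intro integral_dominated_convergence[where w = "\<lambda>_. C + 1"]) auto
    moreover have "(LINT z|N.variation. l z (s n z)) = \<phi> (simple_integral Z \<mu> (s n))" for n
    proof -
      have "((\<lambda>e. \<phi> (\<mu> (s n -` {e} \<inter> Z) e)) has_sum \<phi> (simple_integral Z \<mu> (s n))) (s n ` Z)"
        using has_sum_bounded_linear[OF blinfun.bounded_linear_right simple_integral_has_sum[OF s(1)]]
        by (simp add: o_def)
      with N.simple_integral_has_sum[OF s(1)[of n]] have
        "simple_integral Z (\<lambda>A. \<phi> o\<^sub>L \<mu> A) (s n) = \<phi> (simple_integral Z \<mu> (s n))"
        by (simp add: has_sum_unique)
      with ls(2)[of n] show ?thesis by simp
    qed
    moreover have "(\<lambda>n. \<phi> (simple_integral Z \<mu> (s n))) \<longlonglongrightarrow> \<phi> (integral_op sE Z MM \<mu> f)"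
    proof -
      have "norm (simple_integral Z \<mu> (s n) - integral_op sE Z MM \<mu> f) \<le> total_semivar * inverse (real (Suc n))" for n
        using close by (intro integral_op_approx[OF sE f s(1)]) auto
      moreover have "(\<lambda>n. total_semivar * inverse (real (Suc n))) \<longlonglongrightarrow> total_semivar * 0"
        by (intro tendsto_intros inv0)
      ultimately have "(\<lambda>n. simple_integral Z \<mu> (s n) - integral_op sE Z MM \<mu> f) \<longlonglongrightarrow> 0"
        by (intro Lim_null_comparison[of "\<lambda>n. simple_integral Z \<mu> (s n) - integral_op sE Z MM \<mu> f"]) auto
      then have "(\<lambda>n. simple_integral Z \<mu> (s n)) \<longlonglongrightarrow> integral_op sE Z MM \<mu> f" by (simp add: LIM_zero_iff)
      then show ?thesis by (intro tendsto_intros)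
    qed
    ultimately have "\<phi> (integral_op sE Z MM \<mu> f) = (LINT z|N.variation. l z (f z))"
      using LIMSEQ_unique by simp
    with m show ?thesis by blast
  qed
  show thesis
    by (rule that[of N.variation l]) (use main l V.finite_measure_axioms in auto)
qed

theorem theorem4p11:
  fixes sE :: "'k::real_or_complex \<Rightarrow> 'e::banach \<Rightarrow> 'e"
    and sF :: "'k \<Rightarrow> 'f::banach \<Rightarrow> 'f"
    and Z :: "'z set" and MM :: "'z set set"
    and \<mu> :: "'z set \<Rightarrow> 'e \<Rightarrow>\<^sub>L 'f"
    and f :: "nat \<Rightarrow> 'z \<Rightarrow> 'e" and g :: "'z \<Rightarrow> 'e"
  assumes "banach_space_over sE" and "banach_space_over sF"
    and "sigma_algebra Z MM"
    and "i_measure sE sF MM \<mu>"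
    and "\<And>n. f n \<in> M_space sE Z MM"
    and "\<exists>C. \<forall>n. \<forall>z\<in>Z. norm (f n z) \<le> C"
    and "\<And>z. z \<in> Z \<Longrightarrow> limitin (weak_topology sE) (\<lambda>n. f n z) (g z) sequentially"
  shows "limitin (weak_topology sF)
           (\<lambda>n. integral_op sE Z MM \<mu> (f n)) (integral_op sE Z MM \<mu> g) sequentially"
proof (rule weak_limitI[OF assms(2)])
  fix \<phi> :: "'f \<Rightarrow>\<^sub>L real"
  note sE = assms(1) and f = assms(5) and lim = assms(7)
  interpret sigma_algebra Z MM by fact
  interpret ind_measure Z MM \<mu>
    using assms(4) by unfold_locales (auto simp: i_measure_def)
  obtain C where C: "\<And>n z. z \<in> Z \<Longrightarrow> norm (f n z) \<le> C" using assms(6) by blast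
  obtain D where D: "countable D" "rational_subspace D" and fD: "\<And>n. f n ` Z \<subseteq> closure D"
    and gD: "g ` Z \<subseteq> closure D" and g: "g \<in> M_space sE Z MM"
    using M_space_weak_limit[OF sE f C lim] by blast
  obtain M and l :: "'z \<Rightarrow> 'e \<Rightarrow>\<^sub>L real" where M: "finite_measure M" "space M = Z"
    and l: "\<And>z. norm (l z) \<le> 1"
    and meas: "\<And>f. f \<in> M_space sE Z MM \<Longrightarrow> f ` Z \<subseteq> closure D \<Longrightarrow> (\<lambda>z. l z (f z)) \<in> borel_measurable M"
    and eq: "\<And>f. f \<in> M_space sE Z MM \<Longrightarrow> f ` Z \<subseteq> closure D \<Longrightarrow>
      \<phi> (integral_op sE Z MM \<mu> f) = (LINT z|M. l z (f z))"
    using functional_integral_op_eq[OF sE D, of \<phi>] by blast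
  interpret finite_measure M by fact
  have "(\<lambda>n. LINT z|M. l z (f n z)) \<longlonglongrightarrow> (LINT z|M. l z (g z))"
  \<comment> \<open>The constant \<open>C\<close> is an integrable majorant because \<open>M\<close>
    is finite.\<close>
  proof (rule integral_dominated_convergence[where w = "\<lambda>_. C"])
    \<comment> \<open>The functional \<open>l z\<close> varies with the point but not with
      \<open>n\<close>, so weak convergence at \<open>z\<close> applies to it.\<close>
    show "AE z in M. (\<lambda>n. l z (f n z)) \<longlonglongrightarrow> l z (g z)"
      by (rule AE_I2, rule weak_limit_real_functional[OF sE lim]) (simp add: M(2))
    have "norm (l z (f n z)) \<le> C" if "z \<in> Z" for n z
    proof -
      have "norm (l z (f n z)) \<le> norm (l z) * norm (f n z)" by (rule norm_blinfun)
      also have "\<dots> \<le> norm (f n z)" using l[of z] by (simp add: mult_left_le_one_le)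
      finally show ?thesis using C[OF that, of n] by linarith
    qed
    then show "AE z in M. norm (l z (f n z)) \<le> C" for n by (intro AE_I2) (simp add: M(2))
  qed (use meas[OF g gD] meas[OF f fD] in auto)
  then show "(\<lambda>n. \<phi> (integral_op sE Z MM \<mu> (f n))) \<longlonglongrightarrow> \<phi> (integral_op sE Z MM \<mu> g)"
    by (simp add: eq[OF g gD] eq[OF f fD])
qed

end
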